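(* For every $\lambda\in\mathbb{C}$ with $\operatorname{Im}\lambda\neq0$, the resolvent operator $R(\lambda,A):=(\lambda-A)^{-1}$ exists as a bounded operator defined on all of $H_1$, and it is a compact operator on $H_1$.
   Context: Standing assumptions: $a<c<b$ are real numbers; $q$ is a real-valued function, continuous on $[a,c)$ and on $(c,b]$, with finite one-sided limits $q(c-0)$ and $q(c+0)$. All coefficients $\alpha_{10},\alpha_{11},\alpha_{20},\alpha_{21},\alpha'_{20},\alpha'_{21}$ and $\beta^\pm_{ij}$ ($i=1,2$, $j=0,1$) are real, with $(\alpha_{10},\alpha_{11})\neq(0,0)$. Let $\Delta_{kj}$ denote the determinant formed by the $k$-th and $j$-th columns of the matrix $T=\begin{bmatrix}\beta_{10}^- & \beta_{11}^- & \beta_{10}^+ & \beta_{11}^+\\ \beta_{20}^- & \beta_{21}^- & \beta_{20}^+ & \beta_{21}^+\end{bmatrix}$. It is assumed that $\Delta_{12}>0$, $\Delta_{34}>0$, and $\Delta_0:=\alpha_{21}\alpha'_{20}-\alpha_{20}\alpha'_{21}>0$. Notation: $\mathcal{L}f:=-f''+qf$ on $[a,c)\cup(c,b]$. Define $\tau_1(y):=\alpha_{10}y(a)+\alpha_{11}y'(a)$, $\tau_3(y):=\beta_{11}^-y'(c-)+\beta_{10}^-y(c-)+\beta_{11}^+y'(c+)+\beta_{10}^+y(c+)$, $\tau_4(y):=\beta_{21}^-y'(c-)+\beta_{20}^-y(c-)+\beta_{21}^+y'(c+)+\beta_{20}^+y(c+)$, $T_b(f):=\alpha_{20}f(b)-\alpha_{21}f'(b)$,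 $T'_b(f):=\alpha'_{20}f(b)-\alpha'_{21}f'(b)$. Hilbert space: $H_1=L_2(a,c)\oplus L_2(c,b)\oplus\mathbb{C}$ with inner product, for $F=(f,f_1)$, $G=(g,g_1)$: $\langle F,G\rangle_1:=\Delta_{12}\int_a^{c}f\bar g\,dx+\Delta_{34}\int_c^b f\bar g\,dx+\frac{\Delta_{34}}{\Delta_0}f_1\overline{g_1}$. Operator $A$: $D(A)$ consists of all $(f,f_1)\in H_1$ such that $f$ and $f'$ are absolutely continuous on $[a,c)$ and on $(c,b]$ with finite one-sided limits $f(c\mp0)$, $f'(c\mp0)$ (so they extend absolutely continuously to $[a,c]$ and $[c,b]$), $\mathcal{L}f\in L_2(a,c)\oplus L_2(c,b)$, $\tau_1(f)=\tau_3(f)=\tau_4(f)=0$, and $f_1=T'_b(f)$; for such $F$, $AF:=(\mathcal{L}f,\,-T_b(f))$. *)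

theory Defs
  imports "HOL-Analysis.Analysis"
begin

definition ac_on :: "real \<Rightarrow> real \<Rightarrow> (real \<Rightarrow> 'a::real_normed_vector) \<Rightarrow> bool" where
  "ac_on s t g \<longleftrightarrow>
     (\<forall>\<epsilon>>0. \<exists>\<delta>>0. \<forall>(n::nat) (x::nat \<Rightarrow> real) (y::nat \<Rightarrow> real).
        (\<forall>i<n. s \<le> x i \<and> x i \<le> y i \<and> y i \<le> t) \<and>
        (\<forall>i<n. \<forall>j<n. i \<noteq> j \<longrightarrow> y i \<le> x j \<or> y j \<le> x i) \<and>
        (\<Sum>i<n. y i - x i) < \<delta>
        \<longrightarrow> (\<Sum>i<n. norm (g (y i) - g (x i))) < \<epsilon>)"

definition L2_on :: "real set \<Rightarrow> (real \<Rightarrow> complex) \<Rightarrow> bool" where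
  "L2_on S f \<longleftrightarrow> set_borel_measurable lebesgue S f \<and>
                  set_integrable lebesgue S (\<lambda>x. (cmod (f x))^2)"

text \<open>An element (f, f1) of H1 is represented by the restriction of f to (a,c) (field hl),
 the restriction of f to (c,b) (field hr) and the number f1 (field hc).
 Functions are representatives; elements of H1 are equal iff the representatives agree a.e.\<close>
record H1el =
  hl :: "real \<Rightarrow> complex"
  hr :: "real \<Rightarrow> complex"
  hc :: complex

definition in_H1 :: "real \<Rightarrow> real \<Rightarrow> real \<Rightarrow> H1el \<Rightarrow> bool" where
  "in_H1 a c b F \<longleftrightarrow> L2_on {a<..<c} (hl F) \<and> L2_on {c<..<b} (hr F)"

definition H1_eq :: "real \<Rightarrow> real \<Rightarrow> real \<Rightarrow> H1el \<Rightarrow> H1el \<Rightarrow> bool" where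
  "H1_eq a c b F G \<longleftrightarrow>
     (AE x in lebesgue. x \<in> {a<..<c} \<longrightarrow> hl F x = hl G x) \<and>
     (AE x in lebesgue. x \<in> {c<..<b} \<longrightarrow> hr F x = hr G x) \<and>
     hc F = hc G"

definition H1_diff :: "H1el \<Rightarrow> H1el \<Rightarrow> H1el" where
  "H1_diff F G = \<lparr>hl = (\<lambda>x. hl F x - hl G x), hr = (\<lambda>x. hr F x - hr G x), hc = hc F - hc G\<rparr>"

definition H1_scale :: "complex \<Rightarrow> H1el \<Rightarrow> H1el" where
  "H1_scale \<mu> F = \<lparr>hl = (\<lambda>x. \<mu> * hl F x), hr = (\<lambda>x. \<mu> * hr F x), hc = \<mu> * hc F\<rparr>"

definition Delta12 :: "real \<Rightarrow> real \<Rightarrow> real \<Rightarrow> real \<Rightarrow> real" where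
  "Delta12 bm10 bm11 bm20 bm21 = bm10 * bm21 - bm11 * bm20"

definition Delta34 :: "real \<Rightarrow> real \<Rightarrow> real \<Rightarrow> real \<Rightarrow> real" where
  "Delta34 bp10 bp11 bp20 bp21 = bp10 * bp21 - bp11 * bp20"

definition Delta0 :: "real \<Rightarrow> real \<Rightarrow> real \<Rightarrow> real \<Rightarrow> real" where
  "Delta0 a20 a21 a20' a21' = a21 * a20' - a20 * a21'"

text \<open>Norm of H1 induced by the inner product
 <F,G>_1 = D12 int_a^c f conj g + D34 int_c^b f conj g + (D34/D0) f1 conj g1.\<close>
definition H1_norm :: "real \<Rightarrow> real \<Rightarrow> real \<Rightarrow> real \<Rightarrow> real \<Rightarrow> real \<Rightarrow> H1el \<Rightarrow> real" where
  "H1_norm a c b D12 D34 D0 F =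
     sqrt (D12 * (LINT x:{a<..<c}|lebesgue. (cmod (hl F x))^2)
         + D34 * (LINT x:{c<..<b}|lebesgue. (cmod (hr F x))^2)
         + (D34 / D0) * (cmod (hc F))^2)"

text \<open>A_graph ... F G  means: F is in D(A) and G = A F (as elements of H1, i.e. a.e.).
 u = f on [a,c] (extended to c by f(c-0)), v = f on [c,b] (extended to c by f(c+0));
 u1, v1 are the derivatives f' (existing at every point, one-sided at endpoints),
 u2, v2 are the a.e. derivatives f'' of f'.\<close>
definition A_graph ::
  "real \<Rightarrow> real \<Rightarrow> real \<Rightarrow> (real \<Rightarrow> real) \<Rightarrow>
   real \<Rightarrow> real \<Rightarrow> real \<Rightarrow> real \<Rightarrow> real \<Rightarrow> real \<Rightarrow>
   real \<Rightarrow> real \<Rightarrow> real \<Rightarrow> real \<Rightarrow> real \<Rightarrow> real \<Rightarrow> real \<Rightarrow> real \<Rightarrow>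
   H1el \<Rightarrow> H1el \<Rightarrow> bool" where
  "A_graph a c b q a10 a11 a20 a21 a20' a21'
           bm10 bm11 bm20 bm21 bp10 bp11 bp20 bp21 F G \<longleftrightarrow>
     in_H1 a c b F \<and>
     (\<exists>u1 u2 v1 v2.
        (\<forall>x\<in>{a..c}. (hl F has_vector_derivative u1 x) (at x within {a..c})) \<and>
        (\<forall>x\<in>{c..b}. (hr F has_vector_derivative v1 x) (at x within {c..b})) \<and>
        ac_on a c (hl F) \<and> ac_on a c u1 \<and> ac_on c b (hr F) \<and> ac_on c b v1 \<and>
        (AE x in lebesgue. x \<in> {a<..<c} \<longrightarrow> (u1 has_vector_derivative u2 x) (at x)) \<and>
        (AE x in lebesgue. x \<in> {c<..<b} \<longrightarrow> (v1 has_vector_derivative v2 x) (at x)) \<and>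
        L2_on {a<..<c} (\<lambda>x. - u2 x + complex_of_real (q x) * hl F x) \<and>
        L2_on {c<..<b} (\<lambda>x. - v2 x + complex_of_real (q x) * hr F x) \<and>
        \<comment> \<open>tau_1(f) = 0\<close>
        complex_of_real a10 * hl F a + complex_of_real a11 * u1 a = 0 \<and>
        \<comment> \<open>tau_3(f) = 0\<close>
        complex_of_real bm11 * u1 c + complex_of_real bm10 * hl F c
          + complex_of_real bp11 * v1 c + complex_of_real bp10 * hr F c = 0 \<and>
        \<comment> \<open>tau_4(f) = 0\<close>
        complex_of_real bm21 * u1 c + complex_of_real bm20 * hl F c
          + complex_of_real bp21 * v1 c + complex_of_real bp20 * hr F c = 0 \<and>
        \<comment> \<open>f_1 = T'_b(f)\<close>
        hc F = complex_of_real a20' * hr F b - complex_of_real a21' * v1 b \<and>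
        \<comment> \<open>A F = (L f, - T_b(f))\<close>
        (AE x in lebesgue. x \<in> {a<..<c} \<longrightarrow> hl G x = - u2 x + complex_of_real (q x) * hl F x) \<and>
        (AE x in lebesgue. x \<in> {c<..<b} \<longrightarrow> hr G x = - v2 x + complex_of_real (q x) * hr F x) \<and>
        hc G = - (complex_of_real a20 * hr F b - complex_of_real a21 * v1 b))"

definition lam_minus_A ::
  "real \<Rightarrow> real \<Rightarrow> real \<Rightarrow> (real \<Rightarrow> real) \<Rightarrow>
   real \<Rightarrow> real \<Rightarrow> real \<Rightarrow> real \<Rightarrow> real \<Rightarrow> real \<Rightarrow>
   real \<Rightarrow> real \<Rightarrow> real \<Rightarrow> real \<Rightarrow> real \<Rightarrow> real \<Rightarrow> real \<Rightarrow> real \<Rightarrow>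
   complex \<Rightarrow> H1el \<Rightarrow> H1el \<Rightarrow> bool" where
  "lam_minus_A a c b q a10 a11 a20 a21 a20' a21' bm10 bm11 bm20 bm21 bp10 bp11 bp20 bp21 mu F G \<longleftrightarrow>
     (\<exists>AF. A_graph a c b q a10 a11 a20 a21 a20' a21' bm10 bm11 bm20 bm21 bp10 bp11 bp20 bp21 F AF \<and>
           H1_eq a c b (H1_diff (H1_scale mu F) AF) G)"

end

theory Submission
  imports Defs "HOL-Complex_Analysis.Great_Picard"
begin

text \<open>
  Shooting from the left end point. On each of the two intervals the equation
  \<open>\<lambda>f - \<L>f = g\<close> is a second-order initial value problem with integrable right-hand side,
  uniquely solvable with a bound by the \<open>L\<^sup>1\<close> norm of the data. The condition at \<open>a\<close> leaves one
  complex parameter \<open>\<kappa>\<close>, and since \<open>\<Delta>\<^sub>3\<^sub>4 \<noteq> 0\<close> the transmission conditions carry the solution uniquely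
  across \<open>c\<close>. The last component of the equation then reads \<open>\<omega> \<kappa> = (data)\<close>. If \<open>\<omega> = 0\<close> there is
  an eigenfunction of \<open>A\<close> for \<open>\<lambda>\<close>; it is twice continuously differentiable on both sides of \<open>c\<close>, and the
  Lagrange identity (the symmetry of \<open>A\<close>) gives \<open>Im \<lambda> \<cdot> \<parallel>F\<parallel>\<^sup>2 = 0\<close>, a contradiction.
  Hence \<open>f\<close> and \<open>f'\<close> are bounded uniformly by the norm of the data, which yields boundedness of the
  resolvent, and its compactness by the Arzela--Ascoli theorem.
\<close>

text \<open>The data are only square integrable, so \<open>f''\<close> exists merely almost
  everywhere and determines \<open>f'\<close> only because \<open>f'\<close> is absolutely
  continuous. All estimates are therefore made on the integrated equation, and two bridges connect
  it with \<open>A_graph\<close>: the a.e. derivative of an absolutely continuous function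
  integrates back to its increments (needed for uniqueness and bounds), and a primitive of an
  absolutely integrable function is absolutely continuous with the expected a.e. derivative (needed
  for existence). The symmetry argument avoids this obstacle, since it concerns zero data, whose
  solutions are classical. The weights of the inner product come from determinants: real linear maps
  multiply \<open>Im (y * cnj y')\<close> by their determinant, which is
  \<open>\<Delta>\<^sub>1\<^sub>2\<close> and \<open>\<Delta>\<^sub>3\<^sub>4\<close> on the two
  sides of \<open>c\<close> and \<open>- \<Delta>\<^sub>0\<close> at \<open>b\<close>. With these
  weights the boundary terms assemble into the norm. No Green function is formed. The bound on
  \<open>f'\<close> makes the image of the unit ball uniformly Lipschitz, and this is all that
  compactness uses.\<close>

hide_const (open) Polynomial.content

subsection \<open>Absolutely continuous functions\<close>

text \<open>Reindexing by an arbitrary finite set allows the intervals to be indexed by the tagged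
  pairs of a division.\<close>

lemma ac_on_finite:
  fixes g :: "real \<Rightarrow> 'a::real_normed_vector"
  assumes "ac_on s t g" "\<epsilon> > 0"
  shows "\<exists>\<delta>>0. \<forall>(I::'i set) x y. finite I \<longrightarrow> (\<forall>i\<in>I. s \<le> x i \<and> x i \<le> y i \<and> y i \<le> t) \<longrightarrow>
       (\<forall>i\<in>I. \<forall>j\<in>I. i \<noteq> j \<longrightarrow> y i \<le> x j \<or> y j \<le> x i) \<longrightarrow>
       (\<Sum>i\<in>I. y i - x i) < \<delta> \<longrightarrow> (\<Sum>i\<in>I. norm (g (y i) - g (x i))) < \<epsilon>"
proof -
  obtain \<delta> where "\<delta> > 0" and \<delta>: "\<forall>(n::nat) (x::nat \<Rightarrow> real) (y::nat \<Rightarrow> real).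
        (\<forall>i<n. s \<le> x i \<and> x i \<le> y i \<and> y i \<le> t) \<and>
        (\<forall>i<n. \<forall>j<n. i \<noteq> j \<longrightarrow> y i \<le> x j \<or> y j \<le> x i) \<and>
        (\<Sum>i<n. y i - x i) < \<delta>
        \<longrightarrow> (\<Sum>i<n. norm (g (y i) - g (x i))) < \<epsilon>"
    using assms unfolding ac_on_def by blast
  show ?thesis
  proof (intro exI[of _ \<delta>] conjI \<open>\<delta> > 0\<close> allI impI)
    fix I :: "'i set" and x y
    assume I: "finite I" "\<forall>i\<in>I. s \<le> x i \<and> x i \<le> y i \<and> y i \<le> t"
       "\<forall>i\<in>I. \<forall>j\<in>I. i \<noteq> j \<longrightarrow> y i \<le> x j \<or> y j \<le> x i"
       "(\<Sum>i\<in>I. y i - x i) < \<delta>"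
    obtain h where h: "bij_betw h {..<card I} I"
      using ex_bij_betw_nat_finite[OF I(1)] by (auto simp: atLeast0LessThan)
    have r: "(\<Sum>i\<in>I. \<phi> i) = (\<Sum>i<card I. \<phi> (h i))" for \<phi> :: "'i \<Rightarrow> real"
      using sum.reindex_bij_betw[OF h, of \<phi>] by simp
    have hI: "h i \<in> I" if "i < card I" for i using h that by (auto simp: bij_betw_def)
    have hinj: "h i \<noteq> h j" if "i < card I" "j < card I" "i \<noteq> j" for i j
      using h that by (auto simp: bij_betw_def inj_on_def)
    have "(\<Sum>i<card I. y (h i) - x (h i)) < \<delta>" using I(4) by (simp add: r)
    moreover have "\<forall>i<card I. s \<le> x (h i) \<and> x (h i) \<le> y (h i) \<and> y (h i) \<le> t"
      using I(2) hI by blast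
    moreover have "\<forall>i<card I. \<forall>j<card I. i \<noteq> j \<longrightarrow> y (h i) \<le> x (h j) \<or> y (h j) \<le> x (h i)"
      using I(3) hI hinj by meson
    ultimately have "(\<Sum>i<card I. norm (g (y (h i)) - g (x (h i)))) < \<epsilon>"
      using \<delta>[rule_format, of "card I" "\<lambda>i. x (h i)" "\<lambda>i. y (h i)"] by blast
    then show "(\<Sum>i\<in>I. norm (g (y i) - g (x i))) < \<epsilon>" by (simp add: r)
  qed
qed

text \<open>A tag lies somewhere inside its interval, so the derivative estimate is used on both
  sides of it; the errors \<open>e * (x - u)\<close> and \<open>e * (v - x)\<close> add up to
  \<open>e\<close> times the full length.\<close>

lemma has_vector_derivative_straddle:
  fixes g :: "real \<Rightarrow> 'a::real_normed_vector"
  assumes "(g has_vector_derivative g') (at x)" "e > 0"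
  obtains d where "d > 0"
    "\<And>u v. \<lbrakk>u \<le> x; x \<le> v; {u..v} \<subseteq> ball x d\<rbrakk>
       \<Longrightarrow> norm ((v - u) *\<^sub>R g' - (g v - g u)) \<le> e * (v - u)"
proof -
  obtain d where "d > 0" and d: "\<And>y. norm (y - x) < d \<Longrightarrow>
       norm (g y - g x - (y - x) *\<^sub>R g') \<le> e * norm (y - x)"
    using assms unfolding has_vector_derivative_def has_derivative_within_alt by auto
  show thesis
  proof (rule that[OF \<open>d > 0\<close>])
    fix u v assume uv: "u \<le> x" "x \<le> v" "{u..v} \<subseteq> ball x d"
    have "u \<in> {u..v}" "v \<in> {u..v}" using uv by auto
    then have "u \<in> ball x d" "v \<in> ball x d" using uv(3) by blast+
    then have "norm (u - x) < d" "norm (v - x) < d"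
      using uv by (auto simp: dist_real_def)
    from this[THEN d] have a: "norm (g u - g x - (u - x) *\<^sub>R g') \<le> e * (x - u)"
      "norm (g v - g x - (v - x) *\<^sub>R g') \<le> e * (v - x)"
      using uv by (simp_all add: abs_if split: if_splits)
    have "(v - u) *\<^sub>R g' - (g v - g u) = (g u - g x - (u - x) *\<^sub>R g') - (g v - g x - (v - x) *\<^sub>R g')"
      by (simp add: algebra_simps)
    also have "norm \<dots> \<le> e * (x - u) + e * (v - x)"
      using a norm_triangle_ineq4 by (smt (verit))
    finally show "norm ((v - u) *\<^sub>R g' - (g v - g u)) \<le> e * (v - u)"
      by (simp add: algebra_simps)
  qed
qed

text \<open>Gauge argument: intervals tagged in the exceptional null set lie in an open set of small measure,
  where absolute continuity controls the increments; the other intervals are controlled by the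
  derivative at the tag.\<close>

lemma ac_on_imp_has_integral:
  fixes g h :: "real \<Rightarrow> 'a::banach"
  assumes "s \<le> t" and ac: "ac_on s t g"
    and ae: "AE x in lebesgue. x \<in> {s<..<t} \<longrightarrow> (g has_vector_derivative h x) (at x)"
  shows "(h has_integral (g t - g s)) {s..t}"
proof -
  \<comment> \<open>The endpoints join the exceptional set because the hypothesis speaks only of the
    open interval.\<close>
  define N where "N = {x \<in> {s<..<t}. \<not> (g has_vector_derivative h x) (at x)} \<union> {s, t}"
  obtain N0 where N0: "N0 \<in> null_sets lebesgue"
    "{x. \<not> (x \<in> {s<..<t} \<longrightarrow> (g has_vector_derivative h x) (at x))} \<subseteq> N0"
    using ae by (auto simp: eventually_ae_filter)
  have "negligible N0" using N0 by (simp add: negligible_iff_null_sets)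
  then have "negligible {x \<in> {s<..<t}. \<not> (g has_vector_derivative h x) (at x)}"
    by (rule negligible_subset) (use N0 in auto)
  then have N: "negligible N" unfolding N_def by (intro negligible_Un) auto
  have der: "(g has_vector_derivative h x) (at x)" if "x \<in> {s..t}" "x \<notin> N" for x
    using that by (cases "x \<in> {s<..<t}") (auto simp: N_def)
  \<comment> \<open>With the value 0 on the null set, intervals tagged there contribute only their
    increments of \<open>g\<close>, however large \<open>h\<close> may be.\<close>
  define h' where "h' x = (if x \<in> N then 0 else h x)" for x
  have "(h' has_integral (g t - g s)) {s..t}"
    unfolding has_integral_real
  proof (intro allI impI)
    fix e :: real assume "e > 0"
    then have "e / 3 > 0" by simp
    obtain \<delta> where "\<delta> > 0" and
      \<delta>: "\<forall>(I::(real \<times> real set) set) x y. finite I \<longrightarrow> (\<forall>i\<in>I. s \<le> x i \<and> x i \<le> y i \<and> y i \<le> t) \<longrightarrow>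
       (\<forall>i\<in>I. \<forall>j\<in>I. i \<noteq> j \<longrightarrow> y i \<le> x j \<or> y j \<le> x i) \<longrightarrow>
       (\<Sum>i\<in>I. y i - x i) < \<delta> \<longrightarrow> (\<Sum>i\<in>I. norm (g (y i) - g (x i))) < e / 3"
      using ac_on_finite[OF ac \<open>e / 3 > 0\<close>, where 'i = "real \<times> real set"] by blast
    have "N \<in> sets lebesgue" using N by (simp add: negligible_imp_sets)
    then obtain O' where O: "open O'" "N \<subseteq> O'" "O' - N \<in> lmeasurable"
        "emeasure lebesgue (O' - N) < ennreal \<delta>"
      using sets_lebesgue_outer_open \<open>\<delta> > 0\<close> by metis
    have Om: "O' \<in> lmeasurable"
      using O(2) fmeasurable.Un[OF O(3) negligible_imp_measurable[OF N]]
      by (simp add: Un_absorb2)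
    have "measure lebesgue O' = measure lebesgue (O' - N)"
      using N by (metis measure_Diff_null_set negligible_iff_null_sets Om fmeasurableD)
    also have "\<dots> < \<delta>"
      using O(4) \<open>\<delta> > 0\<close> O(3) by (simp add: emeasure_eq_measure2 ennreal_less_iff)
    finally have Od: "measure lebesgue O' < \<delta>" .
    \<comment> \<open>The derivative errors sum to at most \<open>e' * (t - s)\<close>, hence to at
      most \<open>e / 3\<close>; the summand 1 covers the case \<open>s = t\<close>.\<close>
    define e' where "e' = e / (3 * (t - s + 1))"
    have "e' > 0" using \<open>e > 0\<close> \<open>s \<le> t\<close> by (simp add: e'_def)
    have "\<exists>d>0. \<forall>u v. u \<le> x \<longrightarrow> x \<le> v \<longrightarrow> {u..v} \<subseteq> ball x d
       \<longrightarrow> norm ((v - u) *\<^sub>R h x - (g v - g u)) \<le> e' * (v - u)" if "x \<in> {s..t}" "x \<notin> N" for x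
      using has_vector_derivative_straddle[OF der[OF that] \<open>e' > 0\<close>] by metis
    then obtain d where d0: "\<And>x. \<lbrakk>x \<in> {s..t}; x \<notin> N\<rbrakk> \<Longrightarrow> d x > 0"
      and d: "\<And>x u v. \<lbrakk>x \<in> {s..t}; x \<notin> N; u \<le> x; x \<le> v; {u..v} \<subseteq> ball x (d x)\<rbrakk>
       \<Longrightarrow> norm ((v - u) *\<^sub>R h x - (g v - g u)) \<le> e' * (v - u)"
      by metis
    define \<gamma> where "\<gamma> x = (if x \<in> N then O' else if x \<in> {s..t} then ball x (d x) else ball x 1)" for x
    have "gauge \<gamma>" using O d0 by (auto simp: gauge_def \<gamma>_def)
    have fine: "norm (sum (\<lambda>(x,k). content k *\<^sub>R h' x) \<D> - (g t - g s)) < e"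
      if D: "\<D> tagged_division_of {s..t}" "\<gamma> fine \<D>" for \<D>
    proof -
      have fin: "finite \<D>" using D by blast
      \<comment> \<open>Degenerate intervals are left out: they carry neither length nor increment,
        and disjointness of interiors says nothing about the order of their endpoints, which
        absolute continuity requires.\<close>
      define D1 where "D1 = {p \<in> \<D>. fst p \<in> N \<and> Inf (snd p) < Sup (snd p)}"
      have D1: "D1 \<subseteq> \<D>" "finite D1" using fin by (auto simp: D1_def)
      have k: "\<exists>u v. k = {u..v} \<and> s \<le> u \<and> u \<le> x \<and> x \<le> v \<and> v \<le> t" if "(x, k) \<in> \<D>" for x k
      proof -
        from tagged_division_ofD(2,3,4)[OF D(1) that] obtain u v where "k = {u..v}" "x \<in> k" "k \<subseteq> {s..t}"
          by (auto simp: box_real)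
        then show ?thesis by auto
      qed
      have k': "\<exists>u v. snd p = {u..v} \<and> s \<le> u \<and> u \<le> fst p \<and> fst p \<le> v \<and> v \<le> t" if "p \<in> \<D>" for p
        using k[of "fst p" "snd p"] that by simp
      have k1: "\<exists>u v. snd p = {u..v} \<and> s \<le> u \<and> u < v \<and> v \<le> t" if "p \<in> D1" for p
      proof -
        have "p \<in> \<D>" "Inf (snd p) < Sup (snd p)" using that by (auto simp: D1_def)
        with k'[of p] show ?thesis by auto
      qed
      let ?\<Delta> = "\<lambda>p. g (Sup (snd p)) - g (Inf (snd p))"
      have tel: "(\<Sum>p\<in>\<D>. ?\<Delta> p) = g t - g s"
        using additive_tagged_division_1[OF \<open>s \<le> t\<close> D(1), of g] by (simp add: case_prod_unfold)
      have D1t: "D1 tagged_division_of (\<Union>(snd ` D1))"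
        using D(1) D1(1)
        by (meson tagged_division_of_def tagged_partial_division_of_Union_self tagged_partial_division_subset)
      have "(\<Sum>p\<in>D1. content (snd p)) = (\<Sum>(x,K)\<in>D1. content K)"
        by (simp add: case_prod_unfold)
      also have "\<dots> = sum content (snd ` D1)"
        by (rule sum.over_tagged_division_lemma[OF D1t]) (simp add: content_eq_0_interior)
      also have "\<dots> = sum (measure lebesgue) (snd ` D1)"
      proof (rule sum.cong[OF refl])
        fix K assume "K \<in> snd ` D1"
        then obtain x where "(x, K) \<in> \<D>" by (auto simp: D1_def)
        from k[OF this] show "content K = measure lebesgue K" by auto
      qed
      also have "\<dots> = measure lebesgue (\<Union>(snd ` D1))"
        using content_division[OF division_of_tagged_division[OF D1t]] by simp
      also have "\<dots> \<le> measure lebesgue O'"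
      proof (rule measure_mono_fmeasurable)
        have "snd p \<subseteq> O'" if "p \<in> D1" for p
        proof -
          have "(fst p, snd p) \<in> \<D>" "fst p \<in> N" using that by (auto simp: D1_def)
          then have "snd p \<subseteq> \<gamma> (fst p)" using D(2) unfolding fine_def by blast
          then show ?thesis using \<open>fst p \<in> N\<close> by (simp add: \<gamma>_def)
        qed
        then show "\<Union>(snd ` D1) \<subseteq> O'" by blast
        have "snd p \<in> sets lebesgue" if "p \<in> D1" for p
        proof -
          have "(fst p, snd p) \<in> \<D>" using that by (auto simp: D1_def)
          from k[OF this] show ?thesis by auto
        qed
        then show "\<Union>(snd ` D1) \<in> sets lebesgue"
          using D1(2) by (intro sets.finite_Union) auto
      qed (rule Om)
      finally have "(\<Sum>p\<in>D1. content (snd p)) < \<delta>" using Od by simp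
      moreover have "(\<Sum>p\<in>D1. content (snd p)) = (\<Sum>p\<in>D1. Sup (snd p) - Inf (snd p))"
      proof (rule sum.cong[OF refl])
        fix p assume "p \<in> D1"
        then obtain u v where "snd p = {u..v}" "u < v" using k1 by blast
        then show "content (snd p) = Sup (snd p) - Inf (snd p)" by simp
      qed
      ultimately have small: "(\<Sum>p\<in>D1. Sup (snd p) - Inf (snd p)) < \<delta>" by simp
      have ac1: "(\<Sum>p\<in>D1. norm (?\<Delta> p)) < e / 3"
      proof (rule \<delta>[rule_format, OF D1(2) _ _ small])
        fix p assume "p \<in> D1"
        then show "s \<le> Inf (snd p) \<and> Inf (snd p) \<le> Sup (snd p) \<and> Sup (snd p) \<le> t"
          using k1[of p] by auto
      next
        fix p p' assume pp: "p \<in> D1" "p' \<in> D1" "p \<noteq> p'"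
        obtain u v where p: "snd p = {u..v}" "u < v" using k1[OF pp(1)] by blast
        obtain u' v' where p': "snd p' = {u'..v'}" "u' < v'" using k1[OF pp(2)] by blast
        have "interior (snd p) \<inter> interior (snd p') = {}"
          using tagged_division_ofD(5)[OF D(1), of "fst p" "snd p" "fst p'" "snd p'"] pp D1
          by (auto simp: prod_eq_iff)
        then have dis: "{u<..<v} \<inter> {u'<..<v'} = {}" by (simp add: p p')
        have "v \<le> u' \<or> v' \<le> u"
        proof (rule ccontr)
          assume "\<not> ?thesis"
          then have "max u u' < min v v'" using p p' by auto
          then obtain z where "max u u' < z" "z < min v v'" using dense by blast
          then have "z \<in> {u<..<v} \<inter> {u'<..<v'}" by auto
          then show False using dis by blast
        qed
        then show "Sup (snd p) \<le> Inf (snd p') \<or> Sup (snd p') \<le> Inf (snd p)"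
          using p p' by simp
      qed
      have b: "norm (content (snd p) *\<^sub>R h' (fst p) - ?\<Delta> p) \<le> e' * content (snd p)" if pD: "p \<in> \<D> - D1" for p
      proof -
        obtain u v where uv: "snd p = {u..v}" "s \<le> u" "u \<le> fst p" "fst p \<le> v" "v \<le> t"
          using pD k'[of p] by blast
        consider "u = v" | "u < v" "fst p \<notin> N" using pD uv by (force simp: D1_def)
        then show ?thesis
        proof cases
          case 1
          then show ?thesis by (simp add: uv)
        next
          case 2
          have "{u..v} \<subseteq> ball (fst p) (d (fst p))"
          proof -
            have "(fst p, snd p) \<in> \<D>" using pD by simp
            then have "snd p \<subseteq> \<gamma> (fst p)" using D(2) unfolding fine_def by blast
            then show ?thesis using uv 2 by (simp add: \<gamma>_def)
          qed
          then show ?thesis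
            using d[of "fst p" u v] uv 2 by (simp add: h'_def)
        qed
      qed
      have "sum (\<lambda>(x,k). content k *\<^sub>R h' x) \<D> - (g t - g s)
        = (\<Sum>p\<in>\<D>. content (snd p) *\<^sub>R h' (fst p) - ?\<Delta> p)"
        by (simp only: case_prod_unfold sum_subtractf flip: tel)
      also have "\<dots> = (\<Sum>p\<in>\<D> - D1. content (snd p) *\<^sub>R h' (fst p) - ?\<Delta> p)
             + (\<Sum>p\<in>D1. content (snd p) *\<^sub>R h' (fst p) - ?\<Delta> p)"
        by (rule sum.subset_diff[OF D1(1) fin])
      also have "(\<Sum>p\<in>D1. content (snd p) *\<^sub>R h' (fst p) - ?\<Delta> p) = (\<Sum>p\<in>D1. - ?\<Delta> p)"
        by (rule sum.cong) (auto simp: D1_def h'_def)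
      also have "norm ((\<Sum>p\<in>\<D> - D1. content (snd p) *\<^sub>R h' (fst p) - ?\<Delta> p) + (\<Sum>p\<in>D1. - ?\<Delta> p))
         \<le> (\<Sum>p\<in>\<D> - D1. e' * content (snd p)) + (\<Sum>p\<in>D1. norm (?\<Delta> p))"
        by (intro norm_triangle_mono sum_norm_le b) (auto simp: norm_minus_commute)
      also have "(\<Sum>p\<in>\<D> - D1. e' * content (snd p)) \<le> (\<Sum>p\<in>\<D>. e' * content (snd p))"
        by (rule sum_mono2) (use fin \<open>e' > 0\<close> in auto)
      also have "\<dots> = e' * (t - s)"
        using additive_content_tagged_division[of \<D> s t] D(1) \<open>s \<le> t\<close>
        by (simp add: case_prod_unfold flip: sum_distrib_left)
      also have "\<dots> \<le> e / 3"
        using \<open>e > 0\<close> \<open>s \<le> t\<close> by (simp add: e'_def field_simps)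
      finally show ?thesis using ac1 \<open>e > 0\<close> by simp
    qed
    show "\<exists>\<gamma>. gauge \<gamma> \<and> (\<forall>\<D>. \<D> tagged_division_of {s..t} \<and> \<gamma> fine \<D> \<longrightarrow>
        norm (sum (\<lambda>(x,k). content k *\<^sub>R h' x) \<D> - (g t - g s)) < e)"
    proof (intro exI conjI allI impI; (elim conjE)?)
      show "gauge \<gamma>" by fact
      fix \<D> assume "\<D> tagged_division_of {s..t}" "\<gamma> fine \<D>"
      then show "norm (sum (\<lambda>(x,k). content k *\<^sub>R h' x) \<D> - (g t - g s)) < e"
        by (rule fine)
    qed
  qed
  then show ?thesis
    by (rule has_integral_spike[OF N, rotated]) (auto simp: h'_def)
qed

text \<open>Truncation at a level \<open>m\<close>: \<open>norm (f x)\<close> is at most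
  \<open>m\<close> plus its excess over \<open>m\<close>. By dominated convergence the excess has
  integral below \<open>e / 2\<close> for some \<open>m\<close>, uniformly over all families of
  disjoint intervals, while the truncated part contributes at most \<open>m\<close> times the total
  length.\<close>

lemma ac_on_integral:
  fixes f :: "real \<Rightarrow> 'a::euclidean_space"
  assumes f: "f absolutely_integrable_on {s..t}"
  shows "ac_on s t (\<lambda>x. integral {s..x} f)"
  unfolding ac_on_def
proof (intro allI impI)
  fix e :: real assume "e > 0"
  define F where "F n x = indicator {s..t} x * max 0 (norm (f x) - real n)" for n x
  have fn: "integrable lebesgue (\<lambda>x. indicator {s..t} x * norm (f x))"
    using absolutely_integrable_norm[OF f] by (simp add: set_integrable_def o_def)
  have Fint: "integrable lebesgue (F n)" for n
  proof (rule Bochner_Integration.integrable_bound[OF fn])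
    have "F n = (\<lambda>x. max 0 (indicator {s..t} x * norm (f x) - real n))"
      by (auto simp: F_def fun_eq_iff indicator_def)
    then show "F n \<in> borel_measurable lebesgue"
      using borel_measurable_integrable[OF fn] by simp
  qed (auto simp: F_def indicator_def)
  have "(\<lambda>n. integral\<^sup>L lebesgue (F n)) \<longlonglongrightarrow> integral\<^sup>L lebesgue (\<lambda>x::real. 0::real)"
  proof (rule integral_dominated_convergence[OF _ _ fn])
    show "AE x in lebesgue. (\<lambda>n. F n x) \<longlonglongrightarrow> 0"
    proof (rule AE_I2)
      fix x
      obtain m where m: "norm (f x) \<le> real m" using real_arch_simple by blast
      have "\<forall>\<^sub>F n in sequentially. F n x = 0"
        using eventually_ge_at_top[of m]
        by eventually_elim (use m in \<open>auto simp: F_def\<close>)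
      then show "(\<lambda>n. F n x) \<longlonglongrightarrow> 0" by (simp add: tendsto_eventually)
    qed
    show "F n \<in> borel_measurable lebesgue" for n using Fint by auto
    show "AE x in lebesgue. norm (F n x) \<le> indicator {s..t} x * norm (f x)" for n
      by (rule AE_I2) (auto simp: F_def indicator_def)
  qed auto
  then have "(\<lambda>n. integral\<^sup>L lebesgue (F n)) \<longlonglongrightarrow> 0" by simp
  from order_tendstoD(2)[OF this, of "e / 2"] \<open>e > 0\<close>
  obtain m where m: "integral\<^sup>L lebesgue (F m) < e / 2"
    by (auto simp: eventually_sequentially)
  show "\<exists>\<delta>>0. \<forall>(n::nat) (x::nat \<Rightarrow> real) y.
          (\<forall>i<n. s \<le> x i \<and> x i \<le> y i \<and> y i \<le> t) \<and>
          (\<forall>i<n. \<forall>j<n. i \<noteq> j \<longrightarrow> y i \<le> x j \<or> y j \<le> x i) \<and> (\<Sum>i<n. y i - x i) < \<delta> \<longrightarrow>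
          (\<Sum>i<n. norm (integral {s..y i} f - integral {s..x i} f)) < e"
  \<comment> \<open>The total length times \<open>m\<close> has to stay below \<open>e / 2\<close>;
    \<open>m + 1\<close> in the denominator admits \<open>m = 0\<close>.\<close>
  proof (intro exI[of _ "e / (2 * (real m + 1))"] conjI allI impI; (elim conjE)?)
    show "e / (2 * (real m + 1)) > 0" using \<open>e > 0\<close> by simp
    fix n and x y :: "nat \<Rightarrow> real"
    assume xy: "\<forall>i<n. s \<le> x i \<and> x i \<le> y i \<and> y i \<le> t"
      and dis: "\<forall>i<n. \<forall>j<n. i \<noteq> j \<longrightarrow> y i \<le> x j \<or> y j \<le> x i"
      and sm: "(\<Sum>i<n. y i - x i) < e / (2 * (real m + 1))"
    have Fi: "integrable lebesgue (\<lambda>z. indicator {x i<..<y i} z * F m z)" for i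
      using integrable_mult_indicator[OF _ Fint, of "{x i<..<y i}" m] by simp
    have Ii: "integrable lebesgue (\<lambda>z. indicator {x i<..<y i} z * real m)" for i
    proof (intro integrable_mult_left integrable_real_indicator)
      have "{x i<..<y i} \<in> lmeasurable" using lmeasurable_box[of "x i" "y i"] by simp
      then show "emeasure lebesgue {x i<..<y i} < \<infinity>" by (simp add: fmeasurable_def)
    qed auto
    have each: "norm (integral {s..y i} f - integral {s..x i} f)
       \<le> real m * (y i - x i) + (LINT z|lebesgue. indicator {x i<..<y i} z * F m z)" if "i < n" for i
    proof -
      have i: "s \<le> x i" "x i \<le> y i" "y i \<le> t" using xy that by auto
      have fi: "f absolutely_integrable_on {x i..y i}"
        using absolutely_integrable_on_subinterval[OF f] i by auto
      have "f integrable_on {s..y i}"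
        using absolutely_integrable_on_subinterval[OF f, of s "y i"] i
        by (auto simp: absolutely_integrable_on_def)
      then have "integral {s..y i} f - integral {s..x i} f = integral {x i..y i} f"
        using Henstock_Kurzweil_Integration.integral_combine[of s "x i" "y i" f] i by (simp add: algebra_simps)
      also have "norm \<dots> \<le> integral {x i..y i} (\<lambda>z. norm (f z))"
        using fi by (simp add: absolutely_integrable_on_def integral_norm_bound_integral)
      \<comment> \<open>Open intervals of the family are genuinely disjoint, so their indicators sum
        to at most 1 everywhere; closed ones may share endpoints.\<close>
      also have "\<dots> = integral {x i<..<y i} (\<lambda>z. norm (f z))"
        by (simp add: integral_open_interval_real)
      also have "\<dots> = (LINT z:{x i<..<y i}|lebesgue. norm (f z))"
      proof (rule set_lebesgue_integral_eq_integral(2)[symmetric])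
        show "(\<lambda>z. norm (f z)) absolutely_integrable_on {x i<..<y i}"
          using absolutely_integrable_norm[OF fi] absolutely_integrable_on_Icc_iff_Ioo
          by (auto simp: o_def)
      qed
      also have "\<dots> \<le> (LINT z|lebesgue. indicator {x i<..<y i} z * real m + indicator {x i<..<y i} z * F m z)"
        unfolding set_lebesgue_integral_def
      proof (rule integral_mono)
        show "integrable lebesgue (\<lambda>z. indicat_real {x i<..<y i} z *\<^sub>R norm (f z))"
          using absolutely_integrable_norm[OF fi] absolutely_integrable_on_Icc_iff_Ioo[where f = "\<lambda>z. norm (f z)"]
          by (simp add: set_integrable_def o_def)
        show "integrable lebesgue (\<lambda>z. indicator {x i<..<y i} z * real m + indicator {x i<..<y i} z * F m z)"
          using Ii Fi by (rule Bochner_Integration.integrable_add)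
        show "indicat_real {x i<..<y i} z *\<^sub>R norm (f z)
           \<le> indicator {x i<..<y i} z * real m + indicator {x i<..<y i} z * F m z" for z
          using i by (auto simp: F_def indicator_def)
      qed
      also have "\<dots> = (LINT z|lebesgue. indicator {x i<..<y i} z * real m)
          + (LINT z|lebesgue. indicator {x i<..<y i} z * F m z)"
        using Ii Fi by (rule Bochner_Integration.integral_add)
      also have "(LINT z|lebesgue. indicator {x i<..<y i} z * real m) = real m * (y i - x i)"
        using i by simp
      finally show ?thesis .
    qed
    have "(\<Sum>i<n. LINT z|lebesgue. indicator {x i<..<y i} z * F m z)
       = (LINT z|lebesgue. (\<Sum>i<n. indicator {x i<..<y i} z * F m z))"
      by (rule Bochner_Integration.integral_sum[symmetric]) (rule Fi)
    also have "\<dots> \<le> (LINT z|lebesgue. F m z)"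
    proof (rule integral_mono)
      show "integrable lebesgue (\<lambda>z. \<Sum>i<n. indicator {x i<..<y i} z * F m z)"
        by (rule Bochner_Integration.integrable_sum) (rule Fi)
      show "integrable lebesgue (F m)" by (rule Fint)
      fix z
      have "(\<Sum>i<n. indicator {x i<..<y i} z) \<le> (1::real)"
      proof (cases "\<exists>i<n. z \<in> {x i<..<y i}")
        case True
        then obtain i where i: "i < n" "z \<in> {x i<..<y i}" by blast
        have "indicator {x j<..<y j} z = (0::real)" if "j < n" "j \<noteq> i" for j
        proof -
          have "y j \<le> x i \<or> y i \<le> x j" using dis that i by blast
          then show ?thesis using i by (auto simp: indicator_def)
        qed
        then have "(\<Sum>j<n. indicator {x j<..<y j} z) = (\<Sum>j<n. if j = i then 1 else (0::real))"
          using i by (intro sum.cong) auto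
        also have "\<dots> = 1" using i by simp
        finally show ?thesis by simp
      next
        case False
        then have "(\<Sum>i<n. indicator {x i<..<y i} z) = (0::real)"
          by (intro sum.neutral) (auto simp: indicator_def)
        then show ?thesis by simp
      qed
      moreover have "F m z \<ge> 0" by (simp add: F_def)
      ultimately show "(\<Sum>i<n. indicator {x i<..<y i} z * F m z) \<le> F m z"
        using mult_right_mono[of "\<Sum>i<n. indicator {x i<..<y i} z" 1 "F m z"]
        by (simp add: sum_distrib_right)
    qed
    finally have F: "(\<Sum>i<n. LINT z|lebesgue. indicator {x i<..<y i} z * F m z) < e / 2"
      using m by simp
    have "(\<Sum>i<n. norm (integral {s..y i} f - integral {s..x i} f))
       \<le> (\<Sum>i<n. real m * (y i - x i) + (LINT z|lebesgue. indicator {x i<..<y i} z * F m z))"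
      by (rule sum_mono) (use each in auto)
    also have "\<dots> = real m * (\<Sum>i<n. y i - x i) + (\<Sum>i<n. LINT z|lebesgue. indicator {x i<..<y i} z * F m z)"
      by (simp add: sum.distrib sum_distrib_left)
    also have "real m * (\<Sum>i<n. y i - x i) \<le> real m * (e / (2 * (real m + 1)))"
      using sm by (intro mult_left_mono) auto
    also have "\<dots> \<le> e / 2" using \<open>e > 0\<close> by (simp add: field_simps)
    finally show "(\<Sum>i<n. norm (integral {s..y i} f - integral {s..x i} f)) < e"
      using F by linarith
  qed
qed

text \<open>The Lebesgue differentiation theorem enters through averages over cubes having
  \<open>x\<close> as lower corner. On the line these are the intervals from \<open>x\<close> to
  \<open>x + h\<close>, so only the right-hand derivative comes out.\<close>

lemma integral_right_derivative_AE:
  fixes f :: "real \<Rightarrow> 'a::euclidean_space"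
  assumes f: "f integrable_on {s..t}"
  shows "\<exists>N. negligible N \<and> (\<forall>x\<in>{s<..<t} - N.
     ((\<lambda>x. integral {s..x} f) has_vector_derivative f x) (at_right x))"
proof -
  \<comment> \<open>Extension by zero makes the averages meaningful on every interval of the
    line.\<close>
  define F where "F = (\<lambda>x. if x \<in> {s..t} then f x else 0)"
  have "F integrable_on UNIV" using f unfolding F_def by (simp only: integrable_restrict_UNIV)
  then have Fi: "F integrable_on {u..v}" for u v by (rule integrable_on_subinterval) auto
  then have "F integrable_on cbox u v" for u v by simp
  then have "\<exists>N. negligible N \<and> (\<forall>x e. x \<notin> N \<longrightarrow> 0 < e \<longrightarrow> (\<exists>d>0. \<forall>h. 0 < h \<and> h < d \<longrightarrow>
       norm (integral (cbox x (x + h *\<^sub>R One)) F /\<^sub>R h ^ DIM(real) - F x) < e))"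
    by (rule integrable_ccontinuous_explicit) blast
  then obtain N where N: "negligible N"
    and d: "\<And>x e. \<lbrakk>x \<notin> N; 0 < e\<rbrakk> \<Longrightarrow> \<exists>d>0. \<forall>h. 0 < h \<and> h < d \<longrightarrow>
       norm (integral (cbox x (x + h *\<^sub>R One)) F /\<^sub>R h ^ DIM(real) - F x) < e"
    by meson
  show ?thesis
  proof (rule exI[of _ N], intro conjI N ballI)
    fix x assume x: "x \<in> {s<..<t} - N"
    show "((\<lambda>x. integral {s..x} f) has_vector_derivative f x) (at_right x)"
      unfolding has_vector_derivative_def has_derivative_within_alt
    proof (intro conjI allI impI)
      show "bounded_linear (\<lambda>xa. xa *\<^sub>R f x)" by (rule bounded_linear_scaleR_left)
      fix e :: real assume "e > 0"
      then obtain d where "d > 0" and d: "\<And>h. \<lbrakk>0 < h; h < d\<rbrakk> \<Longrightarrow>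
         norm (integral {x..x + h} F /\<^sub>R h - F x) < e"
        using d[of x e] x by auto
      show "\<exists>d>0. \<forall>y\<in>{x<..}. norm (y - x) < d \<longrightarrow>
         norm (integral {s..y} f - integral {s..x} f - (y - x) *\<^sub>R f x) \<le> e * norm (y - x)"
      proof (intro exI conjI ballI impI)
        show "min d (t - x) > 0" using \<open>d > 0\<close> x by auto
        fix y assume y: "y \<in> {x<..}" "norm (y - x) < min d (t - x)"
        have eq: "integral {s..z} f = integral {s..z} F" if "z \<le> t" for z
          by (rule integral_cong) (use that in \<open>auto simp: F_def\<close>)
        have "integral {s..y} F - integral {s..x} F = integral {x..y} F"
          using Henstock_Kurzweil_Integration.integral_combine[of s x y F] Fi x y by (simp add: algebra_simps)
        moreover have "norm (integral {x..y} F - (y - x) *\<^sub>R F x) \<le> e * (y - x)"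
        proof -
          have "integral {x..y} F - (y - x) *\<^sub>R F x = (y - x) *\<^sub>R (integral {x..x + (y - x)} F /\<^sub>R (y - x) - F x)"
            using y by (simp add: scaleR_diff_right)
          also have "norm \<dots> \<le> e * (y - x)"
            using d[of "y - x"] y by (simp add: mult.commute)
          finally show ?thesis .
        qed
        moreover have "F x = f x" using x by (simp add: F_def)
        ultimately show "norm (integral {s..y} f - integral {s..x} f - (y - x) *\<^sub>R f x) \<le> e * norm (y - x)"
          using x y by (simp add: eq)
      qed
    qed
  qed
qed

text \<open>The left-hand derivative is the right-hand derivative of the primitive of the reflected
  function \<open>f (- x)\<close>. Its exceptional set is reflected back, and a differentiable image
  of a negligible set is negligible.\<close>

lemma integral_derivative_AE:
  fixes f :: "real \<Rightarrow> 'a::euclidean_space"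
  assumes f: "f integrable_on {s..t}"
  shows "AE x in lebesgue. x \<in> {s<..<t} \<longrightarrow>
     ((\<lambda>x. integral {s..x} f) has_vector_derivative f x) (at x)"
proof -
  let ?I = "\<lambda>x. integral {s..x} f" and ?J = "\<lambda>x. integral {-t..x} (\<lambda>x. f (- x))"
  obtain N1 where N1: "negligible N1"
    "\<And>x. x\<in>{s<..<t} - N1 \<Longrightarrow> (?I has_vector_derivative f x) (at_right x)"
    using integral_right_derivative_AE[OF f] by blast
  have "(\<lambda>x. f (- x)) integrable_on {-t..-s}" using f by simp
  from integral_right_derivative_AE[OF this]
  obtain N2 where N2: "negligible N2"
    "\<And>x. x\<in>{-t<..<-s} - N2 \<Longrightarrow> (?J has_vector_derivative f (- x)) (at_right x)"
    by auto
  have "negligible (uminus ` N2)"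
    by (intro negligible_differentiable_image_negligible N2(1))
      (auto simp: differentiable_on_def)
  then have N: "negligible (N1 \<union> uminus ` N2)" using N1 by simp
  have "(?I has_vector_derivative f x) (at x)" if x: "x \<in> {s<..<t}" "x \<notin> N1 \<union> uminus ` N2" for x
  proof -
    have r: "(?I has_vector_derivative f x) (at_right x)" using N1 x by blast
    have "- x \<notin> N2" using x by force
    then have "(?J has_vector_derivative f x) (at_right (-x))" using N2(2)[of "-x"] x by auto
    moreover have "(uminus has_vector_derivative - 1) (at_left x)"
      by (auto intro!: derivative_eq_intros)
    moreover have "uminus ` {..<x} = {-x<..}" by (auto simp: image_iff)
    ultimately have "((?J \<circ> uminus) has_vector_derivative (- 1) *\<^sub>R f x) (at_left x)"
      by (intro vector_diff_chain_within) simp_all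
    then have d: "((\<lambda>y. integral {s..t} f - (?J \<circ> uminus) y) has_vector_derivative f x) (at_left x)"
      using has_vector_derivative_diff[OF has_vector_derivative_const[of "integral {s..t} f"],
          of "?J \<circ> uminus" "- f x"]
      by simp
    have I: "?I y = integral {s..t} f - (?J \<circ> uminus) y" if "y \<in> {s<..<t}" for y
    proof -
      have "?J (- y) = integral {y..t} f" by simp
      then show ?thesis
        using Henstock_Kurzweil_Integration.integral_combine[of s y t f] f that by (simp add: algebra_simps)
    qed
    have "\<forall>\<^sub>F y in nhds x. y \<in> {s<..<t}"
      by (rule eventually_nhds_in_open) (use x in auto)
    then have "\<forall>\<^sub>F y in nhds x. y \<in> {..<x} \<longrightarrow> ?I y = integral {s..t} f - (?J \<circ> uminus) y"
      by (rule eventually_mono) (use I in blast)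
    from has_vector_derivative_cong_ev[OF this I[OF x(1)]] d
    have l: "(?I has_vector_derivative f x) (at_left x)" by blast
    show ?thesis
      using l r unfolding has_vector_derivative_def has_derivative_within filterlim_at_split
      by blast
  qed
  then have "{x \<in> space lebesgue. \<not> (x \<in> {s<..<t} \<longrightarrow> (?I has_vector_derivative f x) (at x))} \<subseteq> N1 \<union> uminus ` N2"
    by blast
  moreover have "N1 \<union> uminus ` N2 \<in> null_sets lebesgue" using N by (simp add: negligible_iff_null_sets)
  ultimately show ?thesis by (rule AE_I'[rotated])
qed

lemma ac_on_cong:
  assumes "ac_on s t g" "\<And>x. x \<in> {s..t} \<Longrightarrow> g' x = k + g x"
  shows "ac_on s t g'"
  unfolding ac_on_def
proof (intro allI impI)
  fix e :: real assume "e > 0"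
  then obtain d where "d > 0" and d: "\<forall>(n::nat) (x::nat \<Rightarrow> real) y.
        (\<forall>i<n. s \<le> x i \<and> x i \<le> y i \<and> y i \<le> t) \<and>
        (\<forall>i<n. \<forall>j<n. i \<noteq> j \<longrightarrow> y i \<le> x j \<or> y j \<le> x i) \<and> (\<Sum>i<n. y i - x i) < d
        \<longrightarrow> (\<Sum>i<n. norm (g (y i) - g (x i))) < e"
    using assms(1) unfolding ac_on_def by blast
  show "\<exists>d>0. \<forall>(n::nat) (x::nat \<Rightarrow> real) y.
        (\<forall>i<n. s \<le> x i \<and> x i \<le> y i \<and> y i \<le> t) \<and>
        (\<forall>i<n. \<forall>j<n. i \<noteq> j \<longrightarrow> y i \<le> x j \<or> y j \<le> x i) \<and> (\<Sum>i<n. y i - x i) < d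
        \<longrightarrow> (\<Sum>i<n. norm (g' (y i) - g' (x i))) < e"
  proof (intro exI[of _ d] conjI \<open>d > 0\<close> allI impI)
    fix n and x y :: "nat \<Rightarrow> real"
    assume A: "(\<forall>i<n. s \<le> x i \<and> x i \<le> y i \<and> y i \<le> t) \<and>
        (\<forall>i<n. \<forall>j<n. i \<noteq> j \<longrightarrow> y i \<le> x j \<or> y j \<le> x i) \<and> (\<Sum>i<n. y i - x i) < d"
    have "(\<Sum>i<n. norm (g' (y i) - g' (x i))) = (\<Sum>i<n. norm (g (y i) - g (x i)))"
    proof (rule sum.cong[OF refl])
      fix i assume "i \<in> {..<n}"
      then have "x i \<in> {s..t}" "y i \<in> {s..t}" using A by (auto intro: order_trans)
      then show "norm (g' (y i) - g' (x i)) = norm (g (y i) - g (x i))"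
        by (simp add: assms(2))
    qed
    then show "(\<Sum>i<n. norm (g' (y i) - g' (x i))) < e" using d A by simp
  qed
qed

lemma ac_on_subinterval:
  assumes "ac_on s t g" "t' \<le> t"
  shows "ac_on s t' g"
  unfolding ac_on_def
proof (intro allI impI)
  fix e :: real assume "e > 0"
  then obtain d where "d > 0" and d: "\<forall>(n::nat) (x::nat \<Rightarrow> real) y.
        (\<forall>i<n. s \<le> x i \<and> x i \<le> y i \<and> y i \<le> t) \<and>
        (\<forall>i<n. \<forall>j<n. i \<noteq> j \<longrightarrow> y i \<le> x j \<or> y j \<le> x i) \<and> (\<Sum>i<n. y i - x i) < d
        \<longrightarrow> (\<Sum>i<n. norm (g (y i) - g (x i))) < e"
    using assms(1) unfolding ac_on_def by blast
  show "\<exists>d>0. \<forall>(n::nat) (x::nat \<Rightarrow> real) y.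
        (\<forall>i<n. s \<le> x i \<and> x i \<le> y i \<and> y i \<le> t') \<and>
        (\<forall>i<n. \<forall>j<n. i \<noteq> j \<longrightarrow> y i \<le> x j \<or> y j \<le> x i) \<and> (\<Sum>i<n. y i - x i) < d
        \<longrightarrow> (\<Sum>i<n. norm (g (y i) - g (x i))) < e"
  proof (intro exI[of _ d] conjI \<open>d > 0\<close> allI impI)
    fix n and x y :: "nat \<Rightarrow> real"
    assume A: "(\<forall>i<n. s \<le> x i \<and> x i \<le> y i \<and> y i \<le> t') \<and>
        (\<forall>i<n. \<forall>j<n. i \<noteq> j \<longrightarrow> y i \<le> x j \<or> y j \<le> x i) \<and> (\<Sum>i<n. y i - x i) < d"
    then have "\<forall>i<n. s \<le> x i \<and> x i \<le> y i \<and> y i \<le> t" using \<open>t' \<le> t\<close> by force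
    then show "(\<Sum>i<n. norm (g (y i) - g (x i))) < e" using d A by blast
  qed
qed

lemma ac_on_imp_continuous_on:
  assumes "ac_on s t g"
  shows "continuous_on {s..t} g"
  unfolding continuous_on_iff
proof (intro ballI allI impI)
  fix x and e :: real assume x: "x \<in> {s..t}" and "e > 0"
  then obtain d where "d > 0" and d: "\<forall>(n::nat) (x::nat \<Rightarrow> real) y.
        (\<forall>i<n. s \<le> x i \<and> x i \<le> y i \<and> y i \<le> t) \<and>
        (\<forall>i<n. \<forall>j<n. i \<noteq> j \<longrightarrow> y i \<le> x j \<or> y j \<le> x i) \<and> (\<Sum>i<n. y i - x i) < d
        \<longrightarrow> (\<Sum>i<n. norm (g (y i) - g (x i))) < e"
    using assms(1) unfolding ac_on_def by blast
  have *: "norm (g v - g u) < e" if "s \<le> u" "u \<le> v" "v \<le> t" "v - u < d" for u v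
    using d[rule_format, of 1 "\<lambda>_. u" "\<lambda>_. v"] that by simp
  show "\<exists>d>0. \<forall>x'\<in>{s..t}. dist x' x < d \<longrightarrow> dist (g x') (g x) < e"
  proof (intro exI[of _ d] conjI \<open>d > 0\<close> ballI impI)
    fix x' assume "x' \<in> {s..t}" "dist x' x < d"
    then show "dist (g x') (g x) < e"
      using *[of x x'] *[of x' x] x
      by (cases "x \<le> x'") (auto simp: dist_norm norm_minus_commute)
  qed
qed

subsection \<open>Initial value problems with integrable right-hand side\<close>

text \<open>\<open>u'' = Q u + g\<close> with \<open>w = u'\<close>, in integrated form because \<open>g\<close> is only integrable.\<close>

definition volterra_sol :: "real \<Rightarrow> real \<Rightarrow> (real \<Rightarrow> complex) \<Rightarrow> (real \<Rightarrow> complex) \<Rightarrow>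
    (real \<Rightarrow> complex) \<Rightarrow> (real \<Rightarrow> complex) \<Rightarrow> bool" where
  "volterra_sol s t Q g u w \<longleftrightarrow> continuous_on {s..t} u \<and> continuous_on {s..t} w \<and>
     (\<forall>x\<in>{s..t}. (w has_integral (u x - u s)) {s..x}) \<and>
     (\<forall>x\<in>{s..t}. ((\<lambda>y. Q y * u y + g y) has_integral (w x - w s)) {s..x})"

section \<open>Exponential weights: the a priori bound and the solution of the initial value
  problem\<close>

lemma has_integral_exp_shift:
  fixes \<mu> s x :: real
  assumes "\<mu> > 0" "s \<le> x"
  shows "((\<lambda>y. exp (\<mu> * (y - s))) has_integral (exp (\<mu> * (x - s)) - 1) / \<mu>) {s..x}"
proof -
  have "((\<lambda>y. exp (\<mu> * (y - s))) has_integral exp (\<mu> * (x - s)) / \<mu> - exp (\<mu> * (s - s)) / \<mu>) {s..x}"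
    using assms
    by (intro fundamental_theorem_of_calculus)
      (auto intro!: derivative_eq_intros simp flip: has_real_derivative_iff_has_vector_derivative)
  then show ?thesis by (simp add: diff_divide_distrib)
qed

text \<open>Integration gains a factor \<open>1 / \<mu>\<close> on functions of growth
  \<open>exp (\<mu> * (y - s))\<close>. This gain drives both the Gronwall inequality and the
  contraction below.\<close>

lemma norm_integral_exp_shift_bound:
  fixes h :: "real \<Rightarrow> 'a::banach" and \<mu> s x :: real
  assumes "\<mu> > 0" "s \<le> x" "h integrable_on {s..x}" "M \<ge> 0"
    and "\<And>y. y \<in> {s..x} \<Longrightarrow> norm (h y) \<le> M * exp (\<mu> * (y - s))"
  shows "norm (integral {s..x} h) \<le> M / \<mu> * exp (\<mu> * (x - s))"
proof -
  note I = has_integral_mult_right[OF has_integral_exp_shift[OF assms(1,2)], of M]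
  have "norm (integral {s..x} h) \<le> integral {s..x} (\<lambda>y. M * exp (\<mu> * (y - s)))"
    by (rule Henstock_Kurzweil_Integration.integral_norm_bound_integral)
      (use assms I in \<open>auto intro: has_integral_integrable\<close>)
  also have "\<dots> = M / \<mu> * exp (\<mu> * (x - s)) - M / \<mu>"
    using integral_unique[OF I] by (simp add: right_diff_distrib diff_divide_distrib)
  finally show ?thesis using assms by (smt (verit) divide_nonneg_pos)
qed

text \<open>Nothing is differentiated. Let \<open>m\<close> be the maximum of
  \<open>N x / exp (2 * L * (x - s))\<close>. At the maximum point the integral term is at most half
  of \<open>N\<close>, so it is absorbed and \<open>m \<le> 2 * C\<close>. The factors 2 in the
  constant and in the exponent are the price of this absorption.\<close>

lemma gronwall:
  fixes N :: "real \<Rightarrow> real"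
  assumes N: "continuous_on {s..t} N" "\<And>x. x \<in> {s..t} \<Longrightarrow> N x \<ge> 0" and "C \<ge> 0" "L > 0"
    and le: "\<And>x. x \<in> {s..t} \<Longrightarrow> N x \<le> C + L * integral {s..x} N"
    and x: "x \<in> {s..t}"
  shows "N x \<le> 2 * C * exp (2 * L * (t - s))"
proof -
  let ?E = "\<lambda>x. exp (2 * L * (x - s))"
  have "continuous_on {s..t} (\<lambda>x. N x / ?E x)"
    by (intro continuous_intros N) auto
  from continuous_attains_sup[OF _ _ this] x obtain x0 where x0: "x0 \<in> {s..t}"
    and max: "\<And>y. y \<in> {s..t} \<Longrightarrow> N y / ?E y \<le> N x0 / ?E x0"
    by fastforce
  define m where "m = N x0 / ?E x0"
  have m: "N y \<le> m * ?E y" if "y \<in> {s..t}" for y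
    using max[OF that] unfolding m_def[symmetric] by (simp add: field_simps)
  have "m \<ge> 0" using N(2)[OF x0] by (simp add: m_def)
  have "N integrable_on {s..x0}"
    using N x0 by (intro integrable_continuous_interval) (auto intro: continuous_on_subset)
  then have "norm (integral {s..x0} N) \<le> m / (2 * L) * ?E x0"
    using x0 \<open>L > 0\<close> \<open>m \<ge> 0\<close> m N(2)
    by (intro norm_integral_exp_shift_bound) auto
  then have "L * integral {s..x0} N \<le> L * (m / (2 * L) * ?E x0)"
    using \<open>L > 0\<close> by (intro mult_left_mono) auto
  then have "N x0 \<le> C + m / 2 * ?E x0"
    using le[OF x0] \<open>L > 0\<close> by simp
  moreover have "N x0 = m * ?E x0" by (simp add: m_def)
  ultimately have "m * ?E x0 \<le> 2 * C" by simp
  moreover have "?E x0 \<ge> 1" using x0 \<open>L > 0\<close> by simp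
  ultimately have "m \<le> 2 * C"
    using \<open>m \<ge> 0\<close> mult_left_mono[of 1 "?E x0" m] by simp
  have "N x \<le> m * ?E x" using m x by simp
  also have "\<dots> \<le> 2 * C * ?E t"
    using x \<open>L > 0\<close> \<open>m \<le> 2 * C\<close> \<open>m \<ge> 0\<close> by (intro mult_mono) auto
  finally show ?thesis .
qed

lemma volterra_sol_bound:
  assumes "s \<le> t" and Q: "continuous_on {s..t} Q"
  obtains K where "K \<ge> 0" "\<And>g u w x. \<lbrakk>volterra_sol s t Q g u w; g absolutely_integrable_on {s..t}; x \<in> {s..t}\<rbrakk>
     \<Longrightarrow> norm (u x) + norm (w x) \<le> K * (norm (u s) + norm (w s) + integral {s..t} (\<lambda>y. norm (g y)))"
proof -
  obtain B where B: "B > 0" "\<And>x. x \<in> {s..t} \<Longrightarrow> norm (Q x) \<le> B"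
    using compact_imp_bounded[OF compact_continuous_image[OF Q]] by (auto simp: bounded_pos)
  show thesis
  proof (rule that)
    \<comment> \<open>The Gronwall constant for \<open>norm (u x) + norm (w x)\<close> with
      \<open>L = B + 1\<close>, since the integrands for \<open>u\<close> and \<open>w\<close> are
      bounded by \<open>norm (w y)\<close> and \<open>B * norm (u y) + norm (g y)\<close>. It
      depends only on \<open>Q\<close> and the interval, hence is uniform in solution and
      data.\<close>
    show "2 * exp (2 * (B + 1) * (t - s)) \<ge> 0" by simp
    fix g u w x assume sol: "volterra_sol s t Q g u w" and g: "g absolutely_integrable_on {s..t}"
      and x: "x \<in> {s..t}"
    have u: "continuous_on {s..t} u" and w: "continuous_on {s..t} w"
      and iu: "\<And>x. x \<in> {s..t} \<Longrightarrow> (w has_integral (u x - u s)) {s..x}"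
      and iw: "\<And>x. x \<in> {s..t} \<Longrightarrow> ((\<lambda>y. Q y * u y + g y) has_integral (w x - w s)) {s..x}"
      using sol by (auto simp: volterra_sol_def)
    let ?N = "\<lambda>x. norm (u x) + norm (w x)"
    let ?G = "integral {s..t} (\<lambda>y. norm (g y))"
    have gn: "(\<lambda>y. norm (g y)) integrable_on {s..x}" if "x \<in> {s..t}" for x
      using absolutely_integrable_on_subinterval[OF g, of s x] that
      by (auto simp: absolutely_integrable_on_def)
    have un: "(\<lambda>y. norm (u y)) integrable_on {s..x}" "(\<lambda>y. norm (w y)) integrable_on {s..x}"
      if "x \<in> {s..t}" for x
      using that u w
      by (auto intro!: integrable_continuous_interval continuous_intros intro: continuous_on_subset)
    have "?N x \<le> 2 * (norm (u s) + norm (w s) + ?G) * exp (2 * (B + 1) * (t - s))"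
    proof (rule gronwall[of s t ?N])
      show "continuous_on {s..t} ?N" by (intro continuous_intros u w)
      have "?G \<ge> 0" by (rule Henstock_Kurzweil_Integration.integral_nonneg) (use gn \<open>s \<le> t\<close> in auto)
      then show "norm (u s) + norm (w s) + ?G \<ge> 0" by simp
      show "B + 1 > 0" using B by simp
      fix x assume x: "x \<in> {s..t}"
      have "norm (u x - u s) \<le> integral {s..x} (\<lambda>y. norm (w y))"
        using Henstock_Kurzweil_Integration.integral_norm_bound_integral[OF has_integral_integrable[OF iu[OF x]] un(2)[OF x]]
          integral_unique[OF iu[OF x]] by simp
      moreover have "norm (w x - w s) \<le> integral {s..x} (\<lambda>y. B * norm (u y) + norm (g y))"
      proof -
        have "norm (integral {s..x} (\<lambda>y. Q y * u y + g y)) \<le> integral {s..x} (\<lambda>y. B * norm (u y) + norm (g y))"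
        proof (rule Henstock_Kurzweil_Integration.integral_norm_bound_integral)
          show "(\<lambda>y. Q y * u y + g y) integrable_on {s..x}" using iw[OF x] by blast
          show "(\<lambda>y. B * norm (u y) + norm (g y)) integrable_on {s..x}"
            by (rule integrable_add[OF integrable_on_mult_right[OF un(1)[OF x], of B] gn[OF x]])
          fix y assume "y \<in> {s..x}"
          then have "norm (Q y * u y) \<le> B * norm (u y)"
            using B(2)[of y] x by (simp add: norm_mult mult_right_mono)
          then show "norm (Q y * u y + g y) \<le> B * norm (u y) + norm (g y)"
            using norm_triangle_ineq[of "Q y * u y" "g y"] by linarith
        qed
        then show ?thesis using integral_unique[OF iw[OF x]] by simp
      qed
      moreover have "integral {s..x} (\<lambda>y. B * norm (u y) + norm (g y))
         = B * integral {s..x} (\<lambda>y. norm (u y)) + integral {s..x} (\<lambda>y. norm (g y))"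
        using Henstock_Kurzweil_Integration.integral_add[OF integrable_on_mult_right[OF un(1)[OF x], of B] gn[OF x]]
        by (simp only: integral_mult_right)
      moreover have "integral {s..x} (\<lambda>y. norm (g y)) \<le> ?G"
        by (rule integral_subset_le) (use x gn \<open>s \<le> t\<close> in auto)
      moreover have "integral {s..x} ?N = integral {s..x} (\<lambda>y. norm (u y)) + integral {s..x} (\<lambda>y. norm (w y))"
        using un[OF x] by (rule Henstock_Kurzweil_Integration.integral_add)
      moreover have "integral {s..x} (\<lambda>y. norm (u y)) \<ge> 0" "integral {s..x} (\<lambda>y. norm (w y)) \<ge> 0"
        using un[OF x] by (auto intro!: Henstock_Kurzweil_Integration.integral_nonneg)
      moreover have "B * integral {s..x} (\<lambda>y. norm (w y)) \<ge> 0"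
        using B un[OF x] by (auto intro!: mult_nonneg_nonneg Henstock_Kurzweil_Integration.integral_nonneg)
      moreover have "norm (u x) \<le> norm (u s) + norm (u x - u s)" "norm (w x) \<le> norm (w s) + norm (w x - w s)"
        by (simp_all add: norm_triangle_sub)
      ultimately show "?N x \<le> norm (u s) + norm (w s) + ?G + (B + 1) * integral {s..x} ?N"
        by (simp add: algebra_simps)
    qed (use x in auto)
    then show "?N x \<le> 2 * exp (2 * (B + 1) * (t - s)) * (norm (u s) + norm (w s) + ?G)"
      by (simp only: mult_ac)
  qed
qed

text \<open>Fixed point for \<open>w\<close>: in the norm weighted with \<open>exp (- \<mu> (x - s))\<close> each of the two integrations
  gains a factor \<open>1 / \<mu>\<close>, so the iteration contracts with constant \<open>B / \<mu>\<^sup>2 < 1\<close>.\<close>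

lemma volterra_sol_exists:
  assumes "s \<le> t" and Q: "continuous_on {s..t} Q" and g: "g integrable_on {s..t}"
  obtains u w where "volterra_sol s t Q g u w" "u s = \<alpha>" "w s = \<beta>"
proof -
  obtain B where B: "B > 0" "\<And>x. x \<in> {s..t} \<Longrightarrow> norm (Q x) \<le> B"
    using compact_imp_bounded[OF compact_continuous_image[OF Q]] by (auto simp: bounded_pos)
  \<comment> \<open>With this choice \<open>B / \<mu>\<close> and \<open>1 / \<mu>\<close> are both
    below 1, and so is the contraction constant.\<close>
  define \<mu> where "\<mu> = B + 1"
  have "\<mu> > 0" using B by (simp add: \<mu>_def)
  \<comment> \<open>The unknown will be \<open>w\<close> divided by \<open>E\<close>; the ordinary
    supremum norm of the quotient is the weighted norm of \<open>w\<close>.\<close>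
  define E where "E x = complex_of_real (exp (\<mu> * (x - s)))" for x
  have Ec: "continuous_on S E" for S unfolding E_def by (intro continuous_intros)
  have E0: "E x \<noteq> 0" for x by (simp add: E_def)
  have Qg: "(\<lambda>y. Q y * \<alpha> + g y) integrable_on {s..t}"
    by (intro integrable_add integrable_continuous_interval g continuous_intros Q)
  \<comment> \<open>Substituting \<open>u = \<alpha> + \<integral>w\<close> splits
    \<open>Q u + g\<close> into the known part \<open>Q \<alpha> + g\<close>, collected in
    \<open>\<eta>\<close>, and the part linear in \<open>w\<close>, collected in
    \<open>J\<close>.\<close>
  define \<eta> where "\<eta> x = \<beta> + integral {s..x} (\<lambda>y. Q y * \<alpha> + g y)" for x
  have \<eta>: "continuous_on {s..t} \<eta>"
    unfolding \<eta>_def by (intro continuous_intros indefinite_integral_continuous_1 Qg)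
  define I where "I z y = integral {s..y} (\<lambda>r. E r * apply_bcontfun z r)" for z :: "real \<Rightarrow>\<^sub>C complex" and y
  have Iint: "(\<lambda>r. E r * apply_bcontfun z r) integrable_on {x..y}" for z x y
    by (intro integrable_continuous_interval continuous_intros Ec) simp
  have Ic: "continuous_on {s..t} (I z)" for z
    unfolding I_def by (intro indefinite_integral_continuous_1 Iint)
  define J where "J z x = integral {s..x} (\<lambda>y. Q y * I z y)" for z x
  have Jint: "(\<lambda>y. Q y * I z y) integrable_on {s..x}" if "x \<in> {s..t}" for z x
    using that by (intro integrable_continuous_interval continuous_intros continuous_on_subset[OF Q] continuous_on_subset[OF Ic]) auto
  have Jc: "continuous_on {s..t} (J z)" for z
    unfolding J_def using \<open>s \<le> t\<close> by (intro indefinite_integral_continuous_1 Jint) auto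
  define T where "T z x = (\<eta> x + J z x) / E x" for z x
  have Tc: "continuous_on {s..t} (T z)" for z
    unfolding T_def by (intro continuous_intros \<eta> Jc Ec) (simp add: E0)
  \<comment> \<open>Clamping the argument extends a function from \<open>{s..t}\<close> constantly
    to the whole line, so that the iteration acts on the complete space of bounded continuous
    functions there.\<close>
  have "\<exists>h. \<forall>x. apply_bcontfun h x = T z (clamp s t x)" for z
    using continuous_on_cbox_bcontfunE[of s t "T z"] Tc[of z] by (metis interval_cbox)
  then obtain \<T> where \<T>: "\<And>z x. apply_bcontfun (\<T> z) x = T z (clamp s t x)" by metis
  have "\<forall>z z'. dist (\<T> z) (\<T> z') \<le> (B / \<mu> / \<mu>) * dist z z'"
  proof (intro allI dist_bound)
    fix z z' :: "real \<Rightarrow>\<^sub>C complex" and x0 :: real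
    define x where "x = clamp s t x0"
    have x: "x \<in> {s..t}"
      using clamp_in_interval[of s t x0] \<open>s \<le> t\<close> by (simp add: x_def)
    define D where "D = dist z z'"
    have "D \<ge> 0" by (simp add: D_def)
    have I: "norm (I z y - I z' y) \<le> D / \<mu> * exp (\<mu> * (y - s))" if "y \<in> {s..t}" for y
    proof -
      have "norm (integral {s..y} (\<lambda>r. E r * apply_bcontfun z r - E r * apply_bcontfun z' r)) \<le> D / \<mu> * exp (\<mu> * (y - s))"
      proof (rule norm_integral_exp_shift_bound)
        fix r assume "r \<in> {s..y}"
        have "norm (E r * apply_bcontfun z r - E r * apply_bcontfun z' r) = exp (\<mu> * (r - s)) * dist (apply_bcontfun z r) (apply_bcontfun z' r)"
          unfolding right_diff_distrib[symmetric] by (simp add: norm_mult E_def dist_norm)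
        also have "\<dots> \<le> D * exp (\<mu> * (r - s))"
          using dist_bounded[of z r z'] by (simp add: D_def)
        finally show "norm (E r * apply_bcontfun z r - E r * apply_bcontfun z' r) \<le> D * exp (\<mu> * (r - s))" .
      qed (use that \<open>\<mu> > 0\<close> \<open>D \<ge> 0\<close> Iint in \<open>auto intro: integrable_diff\<close>)
      then show ?thesis by (simp add: I_def Henstock_Kurzweil_Integration.integral_diff Iint)
    qed
    have "norm (J z x - J z' x) \<le> B * (D / \<mu>) / \<mu> * exp (\<mu> * (x - s))"
    proof -
      have "norm (integral {s..x} (\<lambda>y. Q y * I z y - Q y * I z' y)) \<le> B * (D / \<mu>) / \<mu> * exp (\<mu> * (x - s))"
      proof (rule norm_integral_exp_shift_bound)
        fix y assume y: "y \<in> {s..x}"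
        then have "y \<in> {s..t}" using x by auto
        then have "norm (Q y * (I z y - I z' y)) \<le> B * (D / \<mu> * exp (\<mu> * (y - s)))"
          unfolding norm_mult using B I[of y] by (intro mult_mono) auto
        then show "norm (Q y * I z y - Q y * I z' y) \<le> B * (D / \<mu>) * exp (\<mu> * (y - s))"
          by (simp add: algebra_simps)
      qed (use x \<open>\<mu> > 0\<close> \<open>D \<ge> 0\<close> B Jint in \<open>auto intro: integrable_diff\<close>)
      then show ?thesis using x by (simp add: J_def Henstock_Kurzweil_Integration.integral_diff Jint)
    qed
    then have "norm ((J z x - J z' x) / E x) \<le> B * (D / \<mu>) / \<mu>"
      by (simp add: norm_divide E_def field_simps)
    moreover have "T z x - T z' x = (J z x - J z' x) / E x"
      by (simp add: T_def diff_divide_distrib add_divide_distrib)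
    ultimately show "dist (apply_bcontfun (\<T> z) x0) (apply_bcontfun (\<T> z') x0) \<le> B / \<mu> / \<mu> * dist z z'"
      by (simp add: \<T> dist_norm D_def flip: x_def)
  qed
  moreover have "0 \<le> B / \<mu> / \<mu>" "B / \<mu> / \<mu> < 1"
  proof -
    have "B / \<mu> < 1" "1 / \<mu> < 1" "1 / \<mu> > 0" "B / \<mu> \<ge> 0" using B by (auto simp: \<mu>_def)
    then show "B / \<mu> / \<mu> < 1"
      using mult_strict_mono[of "B / \<mu>" 1 "1 / \<mu>" 1] by auto
    show "0 \<le> B / \<mu> / \<mu>" using B \<open>\<mu> > 0\<close> by simp
  qed
  ultimately obtain z where z: "\<T> z = z"
    using banach_fix_type[of "B / \<mu> / \<mu>" \<T>] by blast
  define w where "w = (\<lambda>x. E x * apply_bcontfun z x)"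
  define u where "u x = \<alpha> + integral {s..x} w" for x
  have wI: "I z x = u x - \<alpha>" for x by (simp add: I_def u_def w_def)
  have wc: "continuous_on S w" for S unfolding w_def by (intro continuous_intros Ec) simp
  have wi: "w integrable_on {s..x}" for x by (intro integrable_continuous_interval wc)
  have uc: "continuous_on {s..t} u"
    unfolding u_def by (intro continuous_intros indefinite_integral_continuous_1 wi)
  have Qu: "(\<lambda>y. Q y * u y + g y) integrable_on {s..x}" if "x \<in> {s..t}" for x
  proof -
    have "(\<lambda>y. Q y * u y + g y) integrable_on {s..t}"
      by (intro integrable_add integrable_continuous_interval g continuous_intros Q uc)
    then show ?thesis by (rule integrable_on_subinterval) (use that in auto)
  qed
  have w: "w x = \<beta> + integral {s..x} (\<lambda>y. Q y * u y + g y)" if x: "x \<in> {s..t}" for x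
  proof -
    have "clamp s t x = x" using x by (intro clamp_cancel_cbox) simp
    then have "apply_bcontfun z x = T z x" using \<T>[of z x] z by simp
    then have "w x = \<eta> x + J z x" by (simp add: w_def T_def E0)
    also have "\<dots> = \<beta> + (integral {s..x} (\<lambda>y. Q y * \<alpha> + g y) + integral {s..x} (\<lambda>y. Q y * (u y - \<alpha>)))"
      by (simp add: \<eta>_def J_def wI)
    also have "integral {s..x} (\<lambda>y. Q y * \<alpha> + g y) + integral {s..x} (\<lambda>y. Q y * (u y - \<alpha>))
       = integral {s..x} (\<lambda>y. (Q y * \<alpha> + g y) + Q y * (u y - \<alpha>))"
    proof (rule Henstock_Kurzweil_Integration.integral_add[symmetric])
      show "(\<lambda>y. Q y * \<alpha> + g y) integrable_on {s..x}"
        by (rule integrable_on_subinterval[OF Qg]) (use x in auto)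
      show "(\<lambda>y. Q y * (u y - \<alpha>)) integrable_on {s..x}"
        using Jint[OF x, of z] by (simp add: wI)
    qed
    also have "\<dots> = integral {s..x} (\<lambda>y. Q y * u y + g y)"
      by (simp add: algebra_simps)
    finally show ?thesis .
  qed
  have ws: "w s = \<beta>" using w[of s] \<open>s \<le> t\<close> by simp
  show thesis
  proof (rule that[of u w])
    show "u s = \<alpha>" by (simp add: u_def)
    show "w s = \<beta>" by (rule ws)
    show "volterra_sol s t Q g u w"
      unfolding volterra_sol_def
    proof (intro conjI ballI)
      fix x assume x: "x \<in> {s..t}"
      show "(w has_integral u x - u s) {s..x}"
        using integrable_integral[OF wi] by (simp add: u_def)
      show "((\<lambda>y. Q y * u y + g y) has_integral w x - w s) {s..x}"
        using integrable_integral[OF Qu[OF x]] w[OF x] ws by simp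
    qed (rule uc wc)+
  qed
qed

lemma volterra_sol_add_mult:
  assumes "volterra_sol s t Q g u w" "volterra_sol s t Q g' u' w'"
  shows "volterra_sol s t Q (\<lambda>x. g x + k * g' x) (\<lambda>x. u x + k * u' x) (\<lambda>x. w x + k * w' x)"
  unfolding volterra_sol_def
proof (intro conjI ballI)
  fix x assume x: "x \<in> {s..t}"
  have "((\<lambda>y. w y + k * w' y) has_integral ((u x - u s) + k * (u' x - u' s))) {s..x}"
    using assms x by (intro has_integral_add has_integral_mult_right) (auto simp: volterra_sol_def)
  then show "((\<lambda>y. w y + k * w' y) has_integral (u x + k * u' x - (u s + k * u' s))) {s..x}"
    by (simp add: algebra_simps)
  have "((\<lambda>y. (Q y * u y + g y) + k * (Q y * u' y + g' y)) has_integral ((w x - w s) + k * (w' x - w' s))) {s..x}"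
    using assms x by (intro has_integral_add has_integral_mult_right) (auto simp: volterra_sol_def)
  then show "((\<lambda>y. Q y * (u y + k * u' y) + (g y + k * g' y)) has_integral (w x + k * w' x - (w s + k * w' s))) {s..x}"
    by (simp add: algebra_simps)
qed (use assms in \<open>auto simp: volterra_sol_def intro!: continuous_intros\<close>)

text \<open>Only the sum \<open>Q x * u x + g x\<close> enters the integral equation. Besides
  changes on null sets this permits moving terms between coefficient and inhomogeneity; an equation
  with \<open>Q = 0\<close> and the a.e. derivative as data can thus be turned into the intended
  one.\<close>

lemma volterra_sol_spike:
  assumes sol: "volterra_sol s t Q g u w"
    and ae: "AE x in lebesgue. x \<in> {s<..<t} \<longrightarrow> Q x * u x + g x = Q' x * u x + g' x"
  shows "volterra_sol s t Q' g' u w"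
proof -
  obtain N0 where N0: "N0 \<in> null_sets lebesgue"
    "{x. \<not> (x \<in> {s<..<t} \<longrightarrow> Q x * u x + g x = Q' x * u x + g' x)} \<subseteq> N0"
    using ae by (auto simp: eventually_ae_filter)
  then have N: "negligible (N0 \<union> {s, t})" by (simp add: negligible_iff_null_sets)
  have "((\<lambda>y. Q' y * u y + g' y) has_integral (w x - w s)) {s..x}" if x: "x \<in> {s..t}" for x
  proof (rule has_integral_spike[OF N])
    show "((\<lambda>y. Q y * u y + g y) has_integral (w x - w s)) {s..x}"
      using sol x by (simp add: volterra_sol_def)
    show "Q' y * u y + g' y = Q y * u y + g y" if "y \<in> {s..x} - (N0 \<union> {s, t})" for y
    proof -
      have "y \<in> {s<..<t}" "y \<notin> N0" using that x by auto
      then show ?thesis using N0(2) by fastforce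
    qed
  qed
  then show ?thesis using sol by (simp add: volterra_sol_def)
qed

section \<open>Passage between the integrated form and derivatives\<close>

lemma volterra_sol_deriv:
  assumes sol: "volterra_sol s t Q g u w" and x: "x \<in> {s..t}"
  shows "(u has_vector_derivative w x) (at x within {s..t})"
proof -
  have "((\<lambda>x. u s + integral {s..x} w) has_vector_derivative w x) (at x within {s..t})"
    using sol x integral_has_vector_derivative[of s t w x]
    by (auto simp: volterra_sol_def intro!: derivative_eq_intros)
  then show ?thesis
  proof (rule has_vector_derivative_transform[OF x, rotated])
    show "u y = u s + integral {s..y} w" if "y \<in> {s..t}" for y
      using sol that by (auto simp: volterra_sol_def dest!: bspec integral_unique)
  qed
qed

lemma volterra_sol_deriv2:
  assumes sol: "volterra_sol s t Q g u w" and x: "x \<in> {s..t}"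
    and Q: "continuous_on {s..t} Q" and g: "continuous_on {s..t} g"
  shows "(w has_vector_derivative Q x * u x + g x) (at x within {s..t})"
proof -
  have "continuous_on {s..t} (\<lambda>x. Q x * u x + g x)"
    using sol by (intro continuous_intros Q g) (simp add: volterra_sol_def)
  then have "((\<lambda>x. w s + integral {s..x} (\<lambda>x. Q x * u x + g x)) has_vector_derivative Q x * u x + g x) (at x within {s..t})"
    using x integral_has_vector_derivative[of s t "\<lambda>x. Q x * u x + g x" x]
    by (auto intro!: derivative_eq_intros)
  then show ?thesis
  proof (rule has_vector_derivative_transform[OF x, rotated])
    show "w y = w s + integral {s..y} (\<lambda>x. Q x * u x + g x)" if "y \<in> {s..t}" for y
      using sol that by (auto simp: volterra_sol_def dest!: bspec integral_unique)
  qed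
qed

text \<open>Both \<open>u\<close> and \<open>w\<close> are constants plus primitives of absolutely
  integrable functions; this yields the regularity that membership in the domain of \<open>A\<close>
  demands.\<close>

lemma volterra_sol_regular:
  assumes "s \<le> t" and sol: "volterra_sol s t Q g u w" and Q: "continuous_on {s..t} Q"
    and g: "g absolutely_integrable_on {s..t}"
  shows "ac_on s t u" "ac_on s t w"
    "AE x in lebesgue. x \<in> {s<..<t} \<longrightarrow> (w has_vector_derivative Q x * u x + g x) (at x)"
proof -
  have u: "continuous_on {s..t} u" "continuous_on {s..t} w" using sol by (auto simp: volterra_sol_def)
  have "w absolutely_integrable_on {s..t}"
    using absolutely_integrable_continuous[of s t w] u by simp
  from ac_on_integral[OF this] show "ac_on s t u"
  proof (rule ac_on_cong)
    show "u y = u s + integral {s..y} w" if "y \<in> {s..t}" for y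
      using sol that by (auto simp: volterra_sol_def dest!: bspec integral_unique)
  qed
  have "(\<lambda>x. Q x * u x) absolutely_integrable_on {s..t}"
    using absolutely_integrable_continuous[of s t "\<lambda>x. Q x * u x"] u Q
    by (auto intro!: continuous_intros)
  then have h: "(\<lambda>x. Q x * u x + g x) absolutely_integrable_on {s..t}"
    using g by (rule set_integral_add)
  have w: "w y = w s + integral {s..y} (\<lambda>x. Q x * u x + g x)" if "y \<in> {s..t}" for y
      using sol that by (auto simp: volterra_sol_def dest!: bspec integral_unique)
  show "ac_on s t w"
    by (rule ac_on_cong[OF ac_on_integral[OF h] w])
  have "(\<lambda>x. Q x * u x + g x) integrable_on {s..t}"
    using h by (simp add: absolutely_integrable_on_def)
  from integral_derivative_AE[OF this]
  show "AE x in lebesgue. x \<in> {s<..<t} \<longrightarrow> (w has_vector_derivative Q x * u x + g x) (at x)"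
  proof (rule eventually_mono, intro impI)
    fix x assume A: "x \<in> {s<..<t} \<longrightarrow> ((\<lambda>x. integral {s..x} (\<lambda>x. Q x * u x + g x)) has_vector_derivative Q x * u x + g x) (at x)"
      and x: "x \<in> {s<..<t}"
    then have "((\<lambda>y. w s + integral {s..y} (\<lambda>x. Q x * u x + g x)) has_vector_derivative Q x * u x + g x) (at x)"
      by (auto intro!: derivative_eq_intros)
    then show "(w has_vector_derivative Q x * u x + g x) (at x)"
    proof (rule has_vector_derivative_transform_within_open)
      show "w s + integral {s..y} (\<lambda>x. Q x * u x + g x) = w y" if "y \<in> {s<..<t}" for y
        using w[of y] that by simp
    qed (use x in auto)
  qed
qed

text \<open>The converse bridge. The ordinary fundamental theorem handles \<open>u\<close>, which is
  differentiable everywhere; for \<open>w\<close> absolute continuity is decisive, because an a.e.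
  derivative alone does not determine increments.\<close>

lemma volterra_solI:
  assumes "s \<le> t" and u: "\<And>x. x \<in> {s..t} \<Longrightarrow> (u has_vector_derivative w x) (at x within {s..t})"
    and ac: "ac_on s t w"
    and ae: "AE x in lebesgue. x \<in> {s<..<t} \<longrightarrow> (w has_vector_derivative w' x) (at x)"
    and eq: "AE x in lebesgue. x \<in> {s<..<t} \<longrightarrow> w' x = Q x * u x + g x"
  shows "volterra_sol s t Q g u w"
proof -
  have "volterra_sol s t (\<lambda>_. 0) w' u w"
    unfolding volterra_sol_def
  proof (intro conjI ballI)
    show "continuous_on {s..t} w" by (rule ac_on_imp_continuous_on[OF ac])
    show "continuous_on {s..t} u"
      using u by (meson continuous_on_eq_continuous_within has_vector_derivative_continuous)
    fix x assume x: "x \<in> {s..t}"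
    show "(w has_integral u x - u s) {s..x}"
    proof (rule fundamental_theorem_of_calculus)
      fix y assume "y \<in> {s..x}"
      then have "y \<in> {s..t}" using x by simp
      from has_vector_derivative_within_subset[OF u[OF this], of "{s..x}"]
      show "(u has_vector_derivative w y) (at y within {s..x})" using x by simp
    qed (use x in simp)
    have "(w' has_integral w x - w s) {s..x}"
    proof (rule ac_on_imp_has_integral[OF _ ac_on_subinterval[OF ac]])
      show "AE y in lebesgue. y \<in> {s<..<x} \<longrightarrow> (w has_vector_derivative w' y) (at y)"
        using ae by (rule eventually_mono) (use x in auto)
    qed (use x in auto)
    then show "((\<lambda>y. 0 * u y + w' y) has_integral w x - w s) {s..x}" by simp
  qed
  then show ?thesis
    by (rule volterra_sol_spike) (use eq in simp)
qed

text \<open>The derivative of \<open>u * cnj w\<close> is \<open>\<bar>w\<bar>\<^sup>2 + (q - cnj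
  lam) * \<bar>u\<bar>\<^sup>2\<close>; as \<open>q\<close> is real, its imaginary part is
  \<open>Im lam * \<bar>u\<bar>\<^sup>2\<close>. With zero data and continuous \<open>q\<close> it
  exists at every point, so the fundamental theorem applies directly.\<close>

lemma volterra_sol_lagrange:
  fixes q :: "real \<Rightarrow> real"
  assumes "s \<le> t" and sol: "volterra_sol s t (\<lambda>x. of_real (q x) - lam) (\<lambda>_. 0) u w"
    and q: "continuous_on {s..t} q"
  shows "((\<lambda>x. Im lam * (cmod (u x))\<^sup>2) has_integral Im (u t * cnj (w t)) - Im (u s * cnj (w s))) {s..t}"
proof (rule fundamental_theorem_of_calculus[OF \<open>s \<le> t\<close>])
  fix x assume x: "x \<in> {s..t}"
  note du = volterra_sol_deriv[OF sol x]
  have dw: "(w has_vector_derivative (of_real (q x) - lam) * u x) (at x within {s..t})"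
  proof -
    have "continuous_on {s..t} (\<lambda>x. complex_of_real (q x) - lam)"
      by (intro continuous_intros q)
    from volterra_sol_deriv2[OF sol x this] show ?thesis by simp
  qed
  have "((\<lambda>x. u x * cnj (w x)) has_vector_derivative
      u x * cnj ((of_real (q x) - lam) * u x) + w x * cnj (w x)) (at x within {s..t})"
    by (rule has_vector_derivative_mult[OF du bounded_linear.has_vector_derivative[OF bounded_linear_cnj dw]])
  from bounded_linear.has_vector_derivative[OF bounded_linear_Im this]
  have "((\<lambda>x. Im (u x * cnj (w x))) has_vector_derivative
      Im (u x * cnj ((of_real (q x) - lam) * u x) + w x * cnj (w x))) (at x within {s..t})" .
  moreover have "Im (u x * cnj ((of_real (q x) - lam) * u x) + w x * cnj (w x)) = Im lam * (cmod (u x))\<^sup>2"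
    unfolding cmod_power2 by (simp add: power2_eq_square algebra_simps)
  ultimately show "((\<lambda>x. Im (u x * cnj (w x))) has_vector_derivative Im lam * (cmod (u x))\<^sup>2) (at x within {s..t})"
    by simp
qed

lemma volterra_sol_zero:
  assumes "s < t" and sol: "volterra_sol s t Q g u w"
    and int: "integral {s..t} (\<lambda>x. (cmod (u x))\<^sup>2) = 0"
  shows "u s = 0" "w s = 0"
proof -
  have c: "continuous_on {s..t} (\<lambda>x. (cmod (u x))\<^sup>2)"
    using sol by (auto simp: volterra_sol_def intro!: continuous_intros)
  have u: "u x = 0" if "x \<in> {s..t}" for x
    using integral_eq_0_iff[OF c \<open>s < t\<close>] int that by auto
  show "u s = 0" using u \<open>s < t\<close> by simp
  have s: "s \<in> {s..t}" using \<open>s < t\<close> by simp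
  have "((\<lambda>_. 0) has_vector_derivative w s) (at s within {s..t})"
    by (rule has_vector_derivative_transform[OF s _ volterra_sol_deriv[OF sol s]]) (simp add: u)
  then show "w s = 0"
    using vector_derivative_unique_within_closed_interval[OF \<open>s < t\<close>, of s "\<lambda>_. 0" "w s" 0] s by simp
qed

section \<open>Equicontinuity and convergent subsequences\<close>

lemma volterra_sol_lipschitz:
  assumes "volterra_sol s t Q g u w" "\<And>x. x \<in> {s..t} \<Longrightarrow> cmod (w x) \<le> M" "x \<in> {s..t}" "y \<in> {s..t}"
  shows "cmod (u x - u y) \<le> M * \<bar>x - y\<bar>"
proof -
  have "cmod (u x - u y) \<le> M * norm (x - y)"
  proof (rule differentiable_bound[where S = "{s..t}" and f' = "\<lambda>x h. h *\<^sub>R w x"])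
    fix z assume z: "z \<in> {s..t}"
    show "(u has_derivative (\<lambda>h. h *\<^sub>R w z)) (at z within {s..t})"
      using volterra_sol_deriv[OF assms(1) z] by (simp add: has_vector_derivative_def)
    show "onorm (\<lambda>h. h *\<^sub>R w z) \<le> M"
    proof (rule onorm_le)
      show "norm (h *\<^sub>R w z) \<le> M * norm h" for h
        using mult_left_mono[OF assms(2)[OF z], of "\<bar>h\<bar>"] by (simp add: mult.commute)
    qed
  qed (use assms in auto)
  then show ?thesis by simp
qed

lemma uniformly_lipschitz_convergent_subseq:
  fixes f :: "nat \<Rightarrow> real \<Rightarrow> complex"
  assumes "\<And>n x. x \<in> {s..t} \<Longrightarrow> cmod (f n x) \<le> M"
    and lip: "\<And>n x y. \<lbrakk>x \<in> {s..t}; y \<in> {s..t}\<rbrakk> \<Longrightarrow> cmod (f n x - f n y) \<le> M * \<bar>x - y\<bar>"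
  shows "\<exists>g k. continuous_on {s..t} g \<and> strict_mono (k :: nat \<Rightarrow> nat) \<and>
     (\<forall>e>0. \<exists>N. \<forall>n x. n \<ge> N \<and> x \<in> {s..t} \<longrightarrow> cmod (f (k n) x - g x) < e)"
proof -
  have equi: "\<exists>d>0. \<forall>n y. y \<in> {s..t} \<and> norm (x - y) < d \<longrightarrow> cmod (f n x - f n y) < e"
    if "x \<in> {s..t}" "e > 0" for x e
  \<comment> \<open>The constant \<open>\<bar>M\<bar> + 1\<close> is positive whatever the sign of
    \<open>M\<close>.\<close>
  proof (intro exI[of _ "e / (\<bar>M\<bar> + 1)"] conjI allI impI; (elim conjE)?)
    show "e / (\<bar>M\<bar> + 1) > 0" using \<open>e > 0\<close> by (simp add: add_nonneg_pos)
    fix n y assume y: "y \<in> {s..t}" "norm (x - y) < e / (\<bar>M\<bar> + 1)"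
    have "cmod (f n x - f n y) \<le> M * \<bar>x - y\<bar>" using lip that y by blast
    also have "\<dots> \<le> (\<bar>M\<bar> + 1) * \<bar>x - y\<bar>" by (intro mult_right_mono) auto
    also have "\<dots> < e" using y(2) by (simp add: pos_less_divide_eq mult.commute add_nonneg_pos)
    finally show "cmod (f n x - f n y) < e" .
  qed
  show ?thesis
  proof (rule Arzela_Ascoli[OF compact_Icc assms(1) equi])
    fix g and k :: "nat \<Rightarrow> nat"
    assume "continuous_on {s..t} g" "strict_mono k"
      "\<And>e. 0 < e \<Longrightarrow> \<exists>N. \<forall>n x. N \<le> n \<and> x \<in> {s..t} \<longrightarrow> cmod (f (k n) x - g x) < e"
    then show ?thesis by (intro exI[of _ g] exI[of _ k] conjI allI impI)
  qed
qed

subsection \<open>Square-integrable functions and the norm of H1\<close>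

lemma set_integrable_const_Ioo: "set_integrable lebesgue {s<..<t::real} (\<lambda>_. k::real)"
proof -
  have "set_integrable lebesgue {s<..<t} (\<lambda>_. 1::real)"
    unfolding set_integrable_def
    using lmeasurable_box[of s t] by (simp add: fmeasurable_def)
  then have "set_integrable lebesgue {s<..<t} (\<lambda>_. k * 1)" by (rule set_integrable_mult_right)
  then show ?thesis by simp
qed

lemma L2_on_absolutely_integrable:
  assumes "L2_on {s<..<t} f"
  shows "f absolutely_integrable_on {s..t}"
proof -
  have "set_integrable lebesgue {s<..<t} f"
    unfolding set_integrable_def
  proof (rule Bochner_Integration.integrable_bound)
    have "set_integrable lebesgue {s<..<t} (\<lambda>x. 1 + (cmod (f x))\<^sup>2)"
      using assms by (intro set_integral_add set_integrable_const_Ioo) (simp add: L2_on_def)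
    then show "integrable lebesgue (\<lambda>x. indicat_real {s<..<t} x *\<^sub>R (1 + (cmod (f x))\<^sup>2))"
      by (simp add: set_integrable_def)
    show "(\<lambda>x. indicat_real {s<..<t} x *\<^sub>R f x) \<in> borel_measurable lebesgue"
      using assms by (simp add: L2_on_def set_borel_measurable_def)
    \<comment> \<open>On a bounded interval the constant 1 is integrable, so this pointwise bound
      passes from square integrability to integrability.\<close>
    have "y \<le> 1 + y\<^sup>2" for y :: real
      using zero_le_power2[of "y - 1/2"] by (simp add: power2_eq_square algebra_simps)
    then show "AE x in lebesgue. norm (indicat_real {s<..<t} x *\<^sub>R f x) \<le> norm (indicat_real {s<..<t} x *\<^sub>R (1 + (cmod (f x))\<^sup>2))"
      by (intro AE_I2) (auto simp: indicator_def)
  qed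
  then show ?thesis using absolutely_integrable_on_Icc_iff_Ioo by blast
qed

lemma set_integral_const_Ioo: "s \<le> t \<Longrightarrow> (LINT x:{s<..<t::real}|lebesgue. k::real) = k * (t - s)"
  using set_lebesgue_integral_eq_integral(2)[OF set_integrable_const_Ioo[of s t k]]
    integral_open_interval_real[of s t "\<lambda>_. k"]
  by (simp add: mult.commute)

text \<open>A substitute for the Cauchy-Schwarz inequality with a cruder constant: integrate
  \<open>\<bar>f\<bar> \<le> \<sigma> + \<bar>f\<bar>\<^sup>2 / \<sigma>\<close> and take for
  \<open>\<sigma>\<close> the \<open>L\<^sup>2\<close> norm. If that norm is 0, arbitrarily small
  \<open>\<sigma>\<close> serve instead.\<close>

lemma L1_le_L2:
  assumes "s \<le> t" and f: "L2_on {s<..<t} f"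
  shows "integral {s..t} (\<lambda>x. cmod (f x)) \<le> (t - s + 1) * sqrt (LINT x:{s<..<t}|lebesgue. (cmod (f x))\<^sup>2)"
proof -
  define A where "A = (LINT x:{s<..<t}|lebesgue. (cmod (f x))\<^sup>2)"
  have fn: "(\<lambda>x. cmod (f x)) absolutely_integrable_on {s..t}"
    using absolutely_integrable_norm[OF L2_on_absolutely_integrable[OF f]] by (simp add: o_def)
  then have fn': "set_integrable lebesgue {s<..<t} (\<lambda>x. cmod (f x))"
    using absolutely_integrable_on_Icc_iff_Ioo by blast
  have f2: "set_integrable lebesgue {s<..<t} (\<lambda>x. (cmod (f x))\<^sup>2)"
    using f by (simp add: L2_on_def)
  have "A \<ge> 0" unfolding A_def set_lebesgue_integral_def
    by (intro Bochner_Integration.integral_nonneg) (simp add: indicator_def)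
  have I: "integral {s..t} (\<lambda>x. cmod (f x)) = (LINT x:{s<..<t}|lebesgue. cmod (f x))"
    using set_lebesgue_integral_eq_integral(2)[OF fn'] by (simp add: integral_open_interval_real)
  have *: "integral {s..t} (\<lambda>x. cmod (f x)) \<le> \<sigma> * (t - s) + 1 / \<sigma> * A" if "\<sigma> > 0" for \<sigma>
  proof -
    have "(LINT x:{s<..<t}|lebesgue. cmod (f x)) \<le> (LINT x:{s<..<t}|lebesgue. \<sigma> + 1 / \<sigma> * (cmod (f x))\<^sup>2)"
    proof (rule set_integral_mono[OF fn'])
      show "set_integrable lebesgue {s<..<t} (\<lambda>x. \<sigma> + 1 / \<sigma> * (cmod (f x))\<^sup>2)"
        using f2 by (intro set_integral_add set_integrable_const_Ioo set_integrable_mult_right)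
      fix x
      have "0 \<le> (\<sigma> - cmod (f x))\<^sup>2" by simp
      then have "2 * \<sigma> * cmod (f x) \<le> \<sigma>\<^sup>2 + (cmod (f x))\<^sup>2" by (simp add: power2_diff)
      moreover have "0 \<le> \<sigma> * cmod (f x)" using that by simp
      ultimately have "\<sigma> * cmod (f x) \<le> \<sigma>\<^sup>2 + (cmod (f x))\<^sup>2" by linarith
      then show "cmod (f x) \<le> \<sigma> + 1 / \<sigma> * (cmod (f x))\<^sup>2"
        using that by (simp add: field_simps power2_eq_square)
    qed
    also have "\<dots> = (LINT x:{s<..<t}|lebesgue. \<sigma>) + (LINT x:{s<..<t}|lebesgue. 1 / \<sigma> * (cmod (f x))\<^sup>2)"
      using f2 by (intro set_integral_add set_integrable_const_Ioo set_integrable_mult_right)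
    also have "\<dots> = \<sigma> * (t - s) + 1 / \<sigma> * A"
      unfolding A_def by (simp only: set_integral_mult_right set_integral_const_Ioo[OF \<open>s \<le> t\<close>])
    finally show ?thesis using I by simp
  qed
  have "integral {s..t} (\<lambda>x. cmod (f x)) \<le> (t - s + 1) * sqrt A"
  proof (cases "A = 0")
    case False
    then have "sqrt A > 0" using \<open>A \<ge> 0\<close> by simp
    from *[OF this] show ?thesis
      using \<open>A \<ge> 0\<close> by (simp add: real_div_sqrt algebra_simps)
  next
    case True
    have "integral {s..t} (\<lambda>x. cmod (f x)) \<le> 0"
    proof (rule field_le_epsilon)
      fix e :: real assume "e > 0"
      then have "e / (t - s + 1) > 0" using \<open>s \<le> t\<close> by simp
      from *[OF this] True have "integral {s..t} (\<lambda>x. cmod (f x)) \<le> e / (t - s + 1) * (t - s)" by simp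
      also have "\<dots> \<le> e" using \<open>e > 0\<close> \<open>s \<le> t\<close> by (simp add: field_simps)
      finally show "integral {s..t} (\<lambda>x. cmod (f x)) \<le> 0 + e" by simp
    qed
    then show ?thesis using True by simp
  qed
  then show ?thesis by (simp add: A_def)
qed

lemma L2_on_diff:
  assumes "L2_on S f" "L2_on S g" and S: "S \<in> sets lebesgue"
  shows "L2_on S (\<lambda>x. f x - g x)"
proof -
  have mf: "(\<lambda>x. indicat_real S x *\<^sub>R f x) \<in> borel_measurable lebesgue"
    and mg: "(\<lambda>x. indicat_real S x *\<^sub>R g x) \<in> borel_measurable lebesgue"
    using assms by (auto simp: L2_on_def set_borel_measurable_def)
  have m: "(\<lambda>x. indicat_real S x *\<^sub>R (f x - g x)) \<in> borel_measurable lebesgue"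
    using borel_measurable_diff[OF mf mg] by (simp add: scaleR_diff_right)
  have "set_integrable lebesgue S (\<lambda>x. (cmod (f x - g x))\<^sup>2)"
    unfolding set_integrable_def
  proof (rule Bochner_Integration.integrable_bound)
    have "set_integrable lebesgue S (\<lambda>x. 2 * (cmod (f x))\<^sup>2 + 2 * (cmod (g x))\<^sup>2)"
      using assms by (intro set_integral_add set_integrable_mult_right) (auto simp: L2_on_def)
    then show "integrable lebesgue (\<lambda>x. indicat_real S x *\<^sub>R (2 * (cmod (f x))\<^sup>2 + 2 * (cmod (g x))\<^sup>2))"
      by (simp add: set_integrable_def)
    have "(\<lambda>x. (cmod (indicat_real S x *\<^sub>R (f x - g x)))\<^sup>2) \<in> borel_measurable lebesgue"
      by (rule borel_measurable_power[OF measurable_compose[OF m borel_measurable_norm]])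
    moreover have "(\<lambda>x. (cmod (indicat_real S x *\<^sub>R (f x - g x)))\<^sup>2) = (\<lambda>x. indicat_real S x *\<^sub>R (cmod (f x - g x))\<^sup>2)"
      by (auto simp: indicator_def fun_eq_iff)
    ultimately show "(\<lambda>x. indicat_real S x *\<^sub>R (cmod (f x - g x))\<^sup>2) \<in> borel_measurable lebesgue" by simp
    \<comment> \<open>The integrable majorant: the triangle inequality followed by
      \<open>2 * p * r \<le> p\<^sup>2 + r\<^sup>2\<close>.\<close>
    have "(cmod (f x - g x))\<^sup>2 \<le> 2 * (cmod (f x))\<^sup>2 + 2 * (cmod (g x))\<^sup>2" for x
    proof -
      have "(cmod (f x - g x))\<^sup>2 \<le> (cmod (f x) + cmod (g x))\<^sup>2"
        by (intro power_mono norm_triangle_ineq4) simp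
      also have "\<dots> \<le> 2 * (cmod (f x))\<^sup>2 + 2 * (cmod (g x))\<^sup>2"
        using zero_le_power2[of "cmod (f x) - cmod (g x)"] by (simp add: power2_sum power2_diff)
      finally show ?thesis .
    qed
    then show "AE x in lebesgue. norm (indicat_real S x *\<^sub>R (cmod (f x - g x))\<^sup>2)
       \<le> norm (indicat_real S x *\<^sub>R (2 * (cmod (f x))\<^sup>2 + 2 * (cmod (g x))\<^sup>2))"
      by (intro AE_I2) (auto simp: indicator_def)
  qed
  then show ?thesis using m by (simp add: L2_on_def set_borel_measurable_def)
qed

lemma L2_on_continuous:
  assumes "continuous_on {s..t} f"
  shows "L2_on {s<..<t} f"
proof -
  have "f absolutely_integrable_on {s..t}"
    using absolutely_integrable_continuous[of s t f] assms by simp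
  then have "set_integrable lebesgue {s<..<t} f"
    using absolutely_integrable_on_Icc_iff_Ioo by blast
  moreover have "(\<lambda>x. (cmod (f x))\<^sup>2) absolutely_integrable_on {s..t}"
  proof -
    have "continuous_on {s..t} (\<lambda>x. (cmod (f x))\<^sup>2)" by (intro continuous_intros assms)
    then show ?thesis using absolutely_integrable_continuous[of s t "\<lambda>x. (cmod (f x))\<^sup>2"] by simp
  qed
  then have "set_integrable lebesgue {s<..<t} (\<lambda>x. (cmod (f x))\<^sup>2)"
    using absolutely_integrable_on_Icc_iff_Ioo by blast
  ultimately show ?thesis
    by (auto simp: L2_on_def set_integrable_def set_borel_measurable_def)
qed

lemma L2_on_cong:
  assumes "L2_on S f" "\<And>x. x \<in> S \<Longrightarrow> f x = g x"
  shows "L2_on S g"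
proof -
  have "(\<lambda>x. indicat_real S x *\<^sub>R f x) = (\<lambda>x. indicat_real S x *\<^sub>R g x)"
    "(\<lambda>x. indicat_real S x *\<^sub>R (cmod (f x))\<^sup>2) = (\<lambda>x. indicat_real S x *\<^sub>R (cmod (g x))\<^sup>2)"
    using assms(2) by (auto simp: fun_eq_iff indicator_def)
  then show ?thesis
    using assms(1) by (simp add: L2_on_def set_borel_measurable_def set_integrable_def)
qed

lemma set_integral_square_le:
  assumes "s \<le> t" "L2_on {s<..<t} f" "\<And>x. x \<in> {s<..<t} \<Longrightarrow> cmod (f x) \<le> M"
  shows "(LINT x:{s<..<t}|lebesgue. (cmod (f x))\<^sup>2) \<le> (t - s) * M\<^sup>2"
proof -
  have "(LINT x:{s<..<t}|lebesgue. (cmod (f x))\<^sup>2) \<le> (LINT x:{s<..<t}|lebesgue. M\<^sup>2)"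
    using assms by (intro set_integral_mono set_integrable_const_Ioo) (auto simp: L2_on_def intro: power_mono)
  then show ?thesis using set_integral_const_Ioo[OF \<open>s \<le> t\<close>, of "M\<^sup>2"] by (simp add: mult.commute)
qed

lemma set_integral_square_nonneg: "(LINT x:S|lebesgue. (cmod (f x))\<^sup>2) \<ge> 0"
  unfolding set_lebesgue_integral_def
  by (intro Bochner_Integration.integral_nonneg) (simp add: indicator_def)

text \<open>Uniform bounds become bounds in \<open>H\<^sub>1\<close>. The number under the root is
  the squared norm of the element whose three components are all 1.\<close>

lemma H1_norm_le:
  assumes "a \<le> c" "c \<le> b" "in_H1 a c b F" "D12 > 0" "D34 > 0" "D0 > 0"
    and "\<And>x. x \<in> {a<..<c} \<Longrightarrow> cmod (hl F x) \<le> M" "\<And>x. x \<in> {c<..<b} \<Longrightarrow> cmod (hr F x) \<le> M"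
    and "cmod (hc F) \<le> M"
  shows "H1_norm a c b D12 D34 D0 F \<le> sqrt (D12 * (c - a) + D34 * (b - c) + D34 / D0) * M"
proof -
  have "M \<ge> 0" using assms(9) norm_ge_zero order_trans by blast
  have "D12 * (LINT x:{a<..<c}|lebesgue. (cmod (hl F x))\<^sup>2) \<le> D12 * ((c - a) * M\<^sup>2)"
    using assms by (intro mult_left_mono set_integral_square_le) (auto simp: in_H1_def)
  moreover have "D34 * (LINT x:{c<..<b}|lebesgue. (cmod (hr F x))\<^sup>2) \<le> D34 * ((b - c) * M\<^sup>2)"
    using assms by (intro mult_left_mono set_integral_square_le) (auto simp: in_H1_def)
  moreover have "D34 / D0 * (cmod (hc F))\<^sup>2 \<le> D34 / D0 * M\<^sup>2"
    using assms by (intro mult_left_mono power_mono) auto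
  ultimately have "H1_norm a c b D12 D34 D0 F \<le> sqrt ((D12 * (c - a) + D34 * (b - c) + D34 / D0) * M\<^sup>2)"
    unfolding H1_norm_def by (intro real_sqrt_le_mono) (simp add: algebra_simps)
  also have "\<dots> = sqrt (D12 * (c - a) + D34 * (b - c) + D34 / D0) * M"
    using \<open>M \<ge> 0\<close> by (simp add: real_sqrt_mult)
  finally show ?thesis .
qed

lemma H1_norm_ge:
  assumes "D12 > 0" "D34 > 0" "D0 > 0"
  shows "sqrt (LINT x:{a<..<c}|lebesgue. (cmod (hl F x))\<^sup>2) \<le> H1_norm a c b D12 D34 D0 F / sqrt D12"
    and "sqrt (LINT x:{c<..<b}|lebesgue. (cmod (hr F x))\<^sup>2) \<le> H1_norm a c b D12 D34 D0 F / sqrt D34"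
    and "cmod (hc F) \<le> H1_norm a c b D12 D34 D0 F / sqrt (D34 / D0)"
proof -
  note nn = set_integral_square_nonneg[of "{a<..<c}" "hl F"] set_integral_square_nonneg[of "{c<..<b}" "hr F"]
  let ?A = "D12 * (LINT x:{a<..<c}|lebesgue. (cmod (hl F x))\<^sup>2)"
    and ?B = "D34 * (LINT x:{c<..<b}|lebesgue. (cmod (hr F x))\<^sup>2)"
    and ?C = "D34 / D0 * (cmod (hc F))\<^sup>2"
  have p: "?A \<ge> 0" "?B \<ge> 0" "?C \<ge> 0" using nn assms by (auto intro: mult_nonneg_nonneg)
  have "sqrt ?A \<le> H1_norm a c b D12 D34 D0 F" "sqrt ?B \<le> H1_norm a c b D12 D34 D0 F"
    "sqrt ?C \<le> H1_norm a c b D12 D34 D0 F"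
    unfolding H1_norm_def using p by (auto intro!: real_sqrt_le_mono)
  moreover have "sqrt ?C = sqrt (D34 / D0) * cmod (hc F)" by (simp only: real_sqrt_mult) simp
  ultimately show "sqrt (LINT x:{a<..<c}|lebesgue. (cmod (hl F x))\<^sup>2) \<le> H1_norm a c b D12 D34 D0 F / sqrt D12"
    "sqrt (LINT x:{c<..<b}|lebesgue. (cmod (hr F x))\<^sup>2) \<le> H1_norm a c b D12 D34 D0 F / sqrt D34"
    "cmod (hc F) \<le> H1_norm a c b D12 D34 D0 F / sqrt (D34 / D0)"
    using assms by (simp_all only: real_sqrt_mult pos_le_divide_eq[OF real_sqrt_gt_zero] divide_pos_pos mult.commute)
qed

subsection \<open>The boundary-transmission problem\<close>

text \<open>The initial value theory needs a coefficient continuous on a compact interval. The value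
  of \<open>q\<close> at \<open>c\<close> itself is unrelated to its one-sided limits and is
  therefore replaced.\<close>

lemma continuous_on_extend_left:
  fixes q :: "real \<Rightarrow> real"
  assumes "continuous_on {a..<c} q" "(q \<longlongrightarrow> l) (at_left c)"
  shows "continuous_on {a..c} (\<lambda>x. if x < c then q x else l)"
proof (cases "a < c")
  case True
  have "continuous (at x within {a..c}) (\<lambda>x. if x < c then q x else l)" if x: "x \<in> {a..c}" for x
  proof (cases "x < c")
    case lt: True
    have "(q \<longlongrightarrow> q x) (at x within {a..<c})"
      using assms(1) x lt by (auto simp: continuous_on_def)
    moreover have "at x within {a..<c} = at x within {a..c}"
      by (rule at_within_nhd[of _ "{..<c}"]) (use lt in auto)
    ultimately have "(q \<longlongrightarrow> q x) (at x within {a..c})" by simp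
    then have "((\<lambda>x. if x < c then q x else l) \<longlongrightarrow> q x) (at x within {a..c})"
      by (rule Lim_transform_within_open[of _ _ _ _ "{..<c}"]) (use lt in auto)
    then show ?thesis using lt by (simp add: continuous_within)
  next
    case False
    then have "x = c" using x by simp
    have "((\<lambda>x. if x < c then q x else l) \<longlongrightarrow> l) (at_left c)"
      by (rule Lim_transform_eventually[OF assms(2)]) (auto simp: eventually_at_filter)
    then show ?thesis
      using \<open>x = c\<close> True by (simp add: continuous_within at_within_Icc_at_left)
  qed
  then show ?thesis by (simp add: continuous_on_eq_continuous_within)
next
  case False
  then have "{a..c} \<subseteq> {c}" by auto
  then show ?thesis by (rule continuous_on_subset[rotated]) simp
qed

lemma continuous_on_extend_right:
  fixes q :: "real \<Rightarrow> real"
  assumes "continuous_on {c<..b} q" "(q \<longlongrightarrow> l) (at_right c)"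
  shows "continuous_on {c..b} (\<lambda>x. if c < x then q x else l)"
proof -
  have "continuous_on {-b..<-c} (\<lambda>x. q (- x))"
    by (rule continuous_on_compose2[OF assms(1)]) (auto intro!: continuous_intros)
  moreover have "((\<lambda>x. q (- x)) \<longlongrightarrow> l) (at_left (- c))"
    using assms(2) by (simp add: filterlim_at_left_to_right)
  ultimately have "continuous_on {-b..-c} (\<lambda>x. if x < - c then q (- x) else l)"
    by (rule continuous_on_extend_left)
  then have "continuous_on {c..b} (\<lambda>x. (\<lambda>x. if x < - c then q (- x) else l) (- x))"
    by (rule continuous_on_compose2) (auto intro!: continuous_intros)
  then show ?thesis by (simp cong: if_cong)
qed

text \<open>\<open>Im (y * cnj z)\<close> is alternating and real bilinear in the plane vectors of
  real and imaginary parts, so a real matrix acting on \<open>(y, z)\<close> multiplies it by its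
  determinant. Every boundary and transmission condition is evaluated through this identity.\<close>

lemma Im_mult_cnj_real_linear:
  fixes m11 m12 m21 m22 :: real and y z :: complex
  shows "Im ((m11 * y + m12 * z) * cnj (m21 * y + m22 * z)) = (m11 * m22 - m12 * m21) * Im (y * cnj z)"
  by (simp add: algebra_simps)

lemma cramer_2x2:
  fixes p q r s e f x y :: complex
  assumes "p * s - q * r \<noteq> 0"
  shows "p * x + q * y = e \<and> r * x + s * y = f \<longleftrightarrow>
     x = (s * e - q * f) / (p * s - q * r) \<and> y = (p * f - r * e) / (p * s - q * r)"
proof
  assume A: "p * x + q * y = e \<and> r * x + s * y = f"
  have "(p * s - q * r) * x = s * e - q * f" "(p * s - q * r) * y = p * f - r * e"
    using A by (auto simp: algebra_simps)
  then show "x = (s * e - q * f) / (p * s - q * r) \<and> y = (p * f - r * e) / (p * s - q * r)"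
    using assms by (simp add: eq_divide_eq mult.commute)
next
  let ?d = "p * s - q * r"
  assume A: "x = (s * e - q * f) / ?d \<and> y = (p * f - r * e) / ?d"
  then have x: "x * ?d = s * e - q * f" and y: "y * ?d = p * f - r * e" using assms by auto
  have "(p * x + q * y) * ?d = p * (x * ?d) + q * (y * ?d)" by (simp add: algebra_simps)
  also have "\<dots> = e * ?d" unfolding x y by (simp add: algebra_simps)
  finally have 1: "p * x + q * y = e" using assms by simp
  have "(r * x + s * y) * ?d = r * (x * ?d) + s * (y * ?d)" by (simp add: algebra_simps)
  also have "\<dots> = f * ?d" unfolding x y by (simp add: algebra_simps)
  finally have 2: "r * x + s * y = f" using assms by simp
  from 1 2 show "p * x + q * y = e \<and> r * x + s * y = f" ..
qed

section \<open>The problem for a fixed non-real spectral parameter\<close>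

locale sl_problem =
  fixes a c b :: real and q :: "real \<Rightarrow> real" and qcm qcp :: real
    and a10 a11 a20 a21 a20' a21' :: real
    and bm10 bm11 bm20 bm21 bp10 bp11 bp20 bp21 :: real
    and lam :: complex
  assumes ac: "a < c" and cb: "c < b"
    and qm: "continuous_on {a..<c} q" and qp: "continuous_on {c<..b} q"
    and qml: "(q \<longlongrightarrow> qcm) (at_left c)" and qpl: "(q \<longlongrightarrow> qcp) (at_right c)"
    and a1: "(a10, a11) \<noteq> (0, 0)"
    and D12_pos: "Delta12 bm10 bm11 bm20 bm21 > 0" and D34_pos: "Delta34 bp10 bp11 bp20 bp21 > 0"
    and D0_pos: "Delta0 a20 a21 a20' a21' > 0"
    and lam: "Im lam \<noteq> 0"
begin

abbreviation "D12 \<equiv> Delta12 bm10 bm11 bm20 bm21"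
abbreviation "D34 \<equiv> Delta34 bp10 bp11 bp20 bp21"
abbreviation "D0 \<equiv> Delta0 a20 a21 a20' a21'"

definition ql :: "real \<Rightarrow> real" where "ql x = (if x < c then q x else qcm)"
definition qr :: "real \<Rightarrow> real" where "qr x = (if c < x then q x else qcp)"

definition Tb :: "complex \<Rightarrow> complex \<Rightarrow> complex" where
  "Tb y z = of_real a20 * y - of_real a21 * z"
definition Tb' :: "complex \<Rightarrow> complex \<Rightarrow> complex" where
  "Tb' y z = of_real a20' * y - of_real a21' * z"

text \<open>Here \<open>y\<close>, \<open>z\<close> are the value and the derivative at the left of
  \<open>c\<close>, and \<open>y'\<close>, \<open>z'\<close> those at the right; the prime is not
  differentiation.\<close>

definition tau3 :: "complex \<Rightarrow> complex \<Rightarrow> complex \<Rightarrow> complex \<Rightarrow> complex" where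
  "tau3 y z y' z' = of_real bm11 * z + of_real bm10 * y + of_real bp11 * z' + of_real bp10 * y'"
definition tau4 :: "complex \<Rightarrow> complex \<Rightarrow> complex \<Rightarrow> complex \<Rightarrow> complex" where
  "tau4 y z y' z' = of_real bm21 * z + of_real bm20 * y + of_real bp21 * z' + of_real bp20 * y'"

text \<open>The coefficient comes from solving \<open>lam * f - (- f'' + q * f) = g\<close> for
  \<open>f''\<close>.\<close>

abbreviation "sol_l g u w \<equiv> volterra_sol a c (\<lambda>x. of_real (ql x) - lam) g u w"
abbreviation "sol_r g u w \<equiv> volterra_sol c b (\<lambda>x. of_real (qr x) - lam) g u w"

text \<open>The resolvent equation in terms of functions alone. The last condition is the third
  component of \<open>lam * F - A F\<close>, with \<open>T'_b(f)\<close> substituted for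
  \<open>f_1\<close> and \<open>- T_b(f)\<close> for the third component of
  \<open>A F\<close>.\<close>

definition bvp :: "(real \<Rightarrow> complex) \<Rightarrow> (real \<Rightarrow> complex) \<Rightarrow> complex \<Rightarrow> (real \<Rightarrow> complex) \<Rightarrow> (real \<Rightarrow> complex)
    \<Rightarrow> (real \<Rightarrow> complex) \<Rightarrow> (real \<Rightarrow> complex) \<Rightarrow> bool" where
  "bvp gl gr g1 u u1 v v1 \<longleftrightarrow> sol_l gl u u1 \<and> sol_r gr v v1 \<and>
     of_real a10 * u a + of_real a11 * u1 a = 0 \<and>
     tau3 (u c) (u1 c) (v c) (v1 c) = 0 \<and> tau4 (u c) (u1 c) (v c) (v1 c) = 0 \<and>
     lam * Tb' (v b) (v1 b) + Tb (v b) (v1 b) = g1"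

lemma Ql_cont: "continuous_on {a..c} (\<lambda>x. complex_of_real (ql x) - lam)"
  using continuous_on_extend_left[OF qm qml] unfolding ql_def[abs_def] by (intro continuous_intros)

lemma Qr_cont: "continuous_on {c..b} (\<lambda>x. complex_of_real (qr x) - lam)"
  using continuous_on_extend_right[OF qp qpl] unfolding qr_def[abs_def] by (intro continuous_intros)

text \<open>Cramer's rule with determinant \<open>\<Delta>\<^sub>3\<^sub>4\<close>. Read from right
  to left it continues a solution across \<open>c\<close>; from left to right it shows that any
  solution is continued in this way, with coefficients independent of the data.\<close>

lemma transmission:
  obtains m00 m01 m10 m11 :: complex where
    "\<And>y z y' z'. tau3 y z y' z' = 0 \<and> tau4 y z y' z' = 0 \<longleftrightarrow> y' = m00 * y + m01 * z \<and> z' = m10 * y + m11 * z"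
proof -
  let ?d = "complex_of_real bp10 * of_real bp21 - of_real bp11 * of_real bp20"
  have d: "?d \<noteq> 0"
  proof -
    have "complex_of_real (bp10 * bp21 - bp11 * bp20) \<noteq> 0"
      using D34_pos unfolding Delta34_def of_real_eq_0_iff by simp
    then show ?thesis by simp
  qed
  show thesis
  proof (rule that)
    fix y z y' z'
    have "tau3 y z y' z' = 0 \<and> tau4 y z y' z' = 0 \<longleftrightarrow>
       of_real bp10 * y' + of_real bp11 * z' = - (of_real bm10 * y + of_real bm11 * z) \<and>
       of_real bp20 * y' + of_real bp21 * z' = - (of_real bm20 * y + of_real bm21 * z)"
      unfolding tau3_def tau4_def by (simp add: eq_neg_iff_add_eq_0 algebra_simps)
    also have "\<dots> \<longleftrightarrow> y' = (of_real bp11 * of_real bm20 - of_real bp21 * of_real bm10) / ?d * y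
           + (of_real bp11 * of_real bm21 - of_real bp21 * of_real bm11) / ?d * z \<and>
         z' = (of_real bp20 * of_real bm10 - of_real bp10 * of_real bm20) / ?d * y
           + (of_real bp20 * of_real bm11 - of_real bp10 * of_real bm21) / ?d * z"
    proof -
      have n: "of_real bp21 * - (of_real bm10 * y + of_real bm11 * z) - of_real bp11 * - (of_real bm20 * y + of_real bm21 * z)
         = (of_real bp11 * of_real bm20 - of_real bp21 * of_real bm10) * y
           + (of_real bp11 * of_real bm21 - of_real bp21 * of_real bm11) * z"
        "of_real bp10 * - (of_real bm20 * y + of_real bm21 * z) - of_real bp20 * - (of_real bm10 * y + of_real bm11 * z)
         = (of_real bp20 * of_real bm10 - of_real bp10 * of_real bm20) * y
           + (of_real bp20 * of_real bm11 - of_real bp10 * of_real bm21) * z"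
        by (simp_all add: algebra_simps)
      show ?thesis unfolding cramer_2x2[OF d] n by (simp only: add_divide_distrib times_divide_eq_left)
    qed
    finally show "tau3 y z y' z' = 0 \<and> tau4 y z y' z' = 0 \<longleftrightarrow>
       y' = (of_real bp11 * of_real bm20 - of_real bp21 * of_real bm10) / ?d * y
           + (of_real bp11 * of_real bm21 - of_real bp21 * of_real bm11) / ?d * z \<and>
         z' = (of_real bp20 * of_real bm10 - of_real bp10 * of_real bm20) / ?d * y
           + (of_real bp20 * of_real bm11 - of_real bp10 * of_real bm21) / ?d * z" .
  qed
qed

text \<open>The quantity \<open>Im (y * cnj y')\<close> vanishes at \<open>a\<close>, has the jump prescribed by \<open>\<Delta>\<^sub>1\<^sub>2\<close> and \<open>\<Delta>\<^sub>3\<^sub>4\<close> at \<open>c\<close>, and at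
  \<open>b\<close> is zero or has the sign opposite to that of \<open>Im \<lambda>\<close>, while by the Lagrange identity its derivative is
  \<open>Im \<lambda> \<cdot> \<bar>y\<bar>\<^sup>2\<close>.\<close>

lemma bvp_homogeneous_zero:
  assumes "bvp (\<lambda>_. 0) (\<lambda>_. 0) 0 u u1 v v1"
  shows "u a = 0" "u1 a = 0"
proof -
  let ?P = "\<lambda>y z. Im (y * cnj z)"
  have sl: "sol_l (\<lambda>_. 0) u u1" and sr: "sol_r (\<lambda>_. 0) v v1"
    and ba: "of_real a10 * u a + of_real a11 * u1 a = 0"
    and t3: "tau3 (u c) (u1 c) (v c) (v1 c) = 0" and t4: "tau4 (u c) (u1 c) (v c) (v1 c) = 0"
    and bb: "lam * Tb' (v b) (v1 b) + Tb (v b) (v1 b) = 0"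
    using assms by (auto simp: bvp_def)
  let ?U = "integral {a..c} (\<lambda>x. (cmod (u x))\<^sup>2)" and ?V = "integral {c..b} (\<lambda>x. (cmod (v x))\<^sup>2)"
  have L: "Im lam * ?U = ?P (u c) (u1 c) - ?P (u a) (u1 a)"
    using integral_unique[OF volterra_sol_lagrange[OF _ sl]] ac continuous_on_extend_left[OF qm qml]
    by (simp add: ql_def[abs_def])
  have R: "Im lam * ?V = ?P (v b) (v1 b) - ?P (v c) (v1 c)"
    using integral_unique[OF volterra_sol_lagrange[OF _ sr]] cb continuous_on_extend_right[OF qp qpl]
    by (simp add: qr_def[abs_def])
  \<comment> \<open>Pairing the vanishing form at \<open>a\<close> with \<open>u1 a\<close> and with
    \<open>u a\<close> gives \<open>a10\<close> times and \<open>a11\<close> times the quantity; one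
    of these coefficients is nonzero.\<close>
  have Pa: "?P (u a) (u1 a) = 0"
  proof -
    have "?P (of_real a10 * u a + of_real a11 * u1 a) (of_real 0 * u a + of_real 1 * u1 a) = a10 * ?P (u a) (u1 a)"
      "?P (of_real 1 * u a + of_real 0 * u1 a) (of_real a10 * u a + of_real a11 * u1 a) = a11 * ?P (u a) (u1 a)"
      unfolding Im_mult_cnj_real_linear by simp_all
    then show ?thesis using a1 unfolding ba by auto
  qed
  have Pc: "D12 * ?P (u c) (u1 c) = D34 * ?P (v c) (v1 c)"
  proof -
    have e: "of_real bm10 * u c + of_real bm11 * u1 c = - (of_real bp10 * v c + of_real bp11 * v1 c)"
      "of_real bm20 * u c + of_real bm21 * u1 c = - (of_real bp20 * v c + of_real bp21 * v1 c)"
      using t3 t4 unfolding tau3_def tau4_def by (simp_all add: eq_neg_iff_add_eq_0 algebra_simps)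
    have "D12 * ?P (u c) (u1 c) = ?P (of_real bm10 * u c + of_real bm11 * u1 c) (of_real bm20 * u c + of_real bm21 * u1 c)"
      unfolding Im_mult_cnj_real_linear Delta12_def ..
    also have "\<dots> = ?P (of_real bp10 * v c + of_real bp11 * v1 c) (of_real bp20 * v c + of_real bp21 * v1 c)"
      unfolding e by (simp only: complex_cnj_minus minus_mult_minus)
    also have "\<dots> = D34 * ?P (v c) (v1 c)"
      unfolding Im_mult_cnj_real_linear Delta34_def ..
    finally show ?thesis .
  qed
  let ?T = "Tb' (v b) (v1 b)"
  \<comment> \<open>The determinant of the pair \<open>(T'_b, T_b)\<close> is \<open>- D0\<close>,
    and the zero last component says \<open>T_b = - lam * T'_b\<close>; together they fix the sign
    at \<open>b\<close>.\<close>
  have Pb: "D0 * ?P (v b) (v1 b) = - Im lam * (cmod ?T)\<^sup>2"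
  proof -
    have T: "Tb (v b) (v1 b) = - lam * ?T" using bb by (simp add: eq_neg_iff_add_eq_0 add.commute)
    have "?P (of_real a20' * v b + of_real (- a21') * v1 b) (of_real a20 * v b + of_real (- a21) * v1 b)
       = - D0 * ?P (v b) (v1 b)"
      unfolding Im_mult_cnj_real_linear Delta0_def by (simp add: algebra_simps)
    then have "- D0 * ?P (v b) (v1 b) = ?P ?T (Tb (v b) (v1 b))"
      by (simp add: Tb_def Tb'_def)
    also have "\<dots> = Im lam * (cmod ?T)\<^sup>2"
      unfolding T cmod_power2 by (simp add: power2_eq_square algebra_simps)
    finally show ?thesis by simp
  qed
  have nn: "?U \<ge> 0" "?V \<ge> 0"
    using sl sr by (auto intro!: Henstock_Kurzweil_Integration.integral_nonneg integrable_continuous_interval continuous_intros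
        simp: volterra_sol_def)
  \<comment> \<open>The bracket is \<open>D0\<close> times the squared norm of the eigenvector with
    components \<open>u\<close>, \<open>v\<close> and \<open>T'_b\<close>; multiplying by
    \<open>D0\<close> avoids the quotient \<open>D34 / D0\<close>.\<close>
  have "Im lam * (D0 * (D12 * ?U + D34 * ?V) + D34 * (cmod ?T)\<^sup>2)
     = D0 * D12 * (Im lam * ?U) + D0 * D34 * (Im lam * ?V) - D34 * (- Im lam * (cmod ?T)\<^sup>2)"
    by (simp add: algebra_simps)
  also have "\<dots> = D0 * (D12 * ?P (u c) (u1 c)) - D0 * (D34 * ?P (v c) (v1 c))"
    unfolding L R Pb[symmetric] Pa by (simp add: algebra_simps)
  also have "\<dots> = 0" unfolding Pc by simp
  finally have "D0 * (D12 * ?U + D34 * ?V) + D34 * (cmod ?T)\<^sup>2 = 0" using lam by simp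
  moreover have "D0 * (D12 * ?U + D34 * ?V) \<ge> D0 * (D12 * ?U)" "D34 * (cmod ?T)\<^sup>2 \<ge> 0" "D0 * (D12 * ?U) \<ge> 0"
    using nn D0_pos D12_pos D34_pos by simp_all
  ultimately have "D0 * (D12 * ?U) = 0" by linarith
  then have "?U = 0" using D0_pos D12_pos by simp
  then show "u a = 0" "u1 a = 0" using volterra_sol_zero[OF ac sl] by auto
qed

section \<open>Fundamental solution, solvability and the a priori estimate\<close>

abbreviation data_size :: "(real \<Rightarrow> complex) \<Rightarrow> (real \<Rightarrow> complex) \<Rightarrow> complex \<Rightarrow> real" where
  "data_size gl gr g1 \<equiv>
     integral {a..c} (\<lambda>x. cmod (gl x)) + integral {c..b} (\<lambda>x. cmod (gr x)) + cmod g1"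

text \<open>Its value at \<open>b\<close> on the fundamental solution is the number
  \<open>\<omega>\<close> of the shooting argument, a characteristic function of the spectral
  parameter.\<close>

definition boundary_form :: "complex \<Rightarrow> complex \<Rightarrow> complex" where
  "boundary_form y z = lam * Tb' y z + Tb y z"

lemma boundary_form_add_mult: "boundary_form (y + k * y') (z + k * z') = boundary_form y z + k * boundary_form y' z'"
  by (simp add: boundary_form_def Tb_def Tb'_def algebra_simps)

lemma tau_add_mult:
  "tau3 (y + k * y') (z + k * z') (p + k * p') (r + k * r') = tau3 y z p r + k * tau3 y' z' p' r'"
  "tau4 (y + k * y') (z + k * z') (p + k * p') (r + k * r') = tau4 y z p r + k * tau4 y' z' p' r'"
  by (simp_all add: tau3_def tau4_def algebra_simps)

lemma boundary_form_bound: "cmod (boundary_form y z) \<le> (cmod (boundary_form 1 0) + cmod (boundary_form 0 1)) * (cmod y + cmod z)"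
proof -
  have "boundary_form y z = boundary_form 1 0 * y + boundary_form 0 1 * z"
    by (simp add: boundary_form_def Tb_def Tb'_def algebra_simps)
  then have "cmod (boundary_form y z) \<le> cmod (boundary_form 1 0) * cmod y + cmod (boundary_form 0 1) * cmod z"
    by (metis norm_mult norm_triangle_ineq)
  also have "\<dots> \<le> (cmod (boundary_form 1 0) + cmod (boundary_form 0 1)) * (cmod y + cmod z)"
    by (simp add: algebra_simps)
  finally show ?thesis .
qed

lemma bvp_add_mult:
  assumes "bvp gl gr g1 u u1 v v1" "bvp gl' gr' g1' u' u1' v' v1'"
  shows "bvp (\<lambda>x. gl x + k * gl' x) (\<lambda>x. gr x + k * gr' x) (g1 + k * g1')
    (\<lambda>x. u x + k * u' x) (\<lambda>x. u1 x + k * u1' x) (\<lambda>x. v x + k * v' x) (\<lambda>x. v1 x + k * v1' x)"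
proof -
  have "of_real a10 * (u a + k * u' a) + of_real a11 * (u1 a + k * u1' a)
    = (of_real a10 * u a + of_real a11 * u1 a) + k * (of_real a10 * u' a + of_real a11 * u1' a)"
    by (simp add: algebra_simps)
  then show ?thesis
    using assms unfolding bvp_def boundary_form_def[symmetric] boundary_form_add_mult tau_add_mult
    by (auto intro: volterra_sol_add_mult)
qed

text \<open>The initial vector \<open>(a11, - a10)\<close> spans the kernel of the condition at
  \<open>a\<close> and is nonzero. If the boundary form vanished at \<open>b\<close>, this solution
  would be a homogeneous one, whose initial vector has been shown to be zero.\<close>

lemma fundamental_solution:
  obtains p p1 r r1 where "sol_l (\<lambda>_. 0) p p1" "sol_r (\<lambda>_. 0) r r1" "p a = of_real a11" "p1 a = - of_real a10"
    "tau3 (p c) (p1 c) (r c) (r1 c) = 0" "tau4 (p c) (p1 c) (r c) (r1 c) = 0" "boundary_form (r b) (r1 b) \<noteq> 0"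
proof -
  obtain m00 m01 m10 m11 where m: "\<And>y z y' z'. tau3 y z y' z' = 0 \<and> tau4 y z y' z' = 0 \<longleftrightarrow>
     y' = m00 * y + m01 * z \<and> z' = m10 * y + m11 * z"
    by (rule transmission) blast
  obtain p p1 where p: "sol_l (\<lambda>_. 0) p p1" "p a = of_real a11" "p1 a = - of_real a10"
    using volterra_sol_exists[of a c _ "\<lambda>_. 0" "of_real a11" "- of_real a10", OF _ Ql_cont] ac by auto
  obtain r r1 where r: "sol_r (\<lambda>_. 0) r r1" "r c = m00 * p c + m01 * p1 c" "r1 c = m10 * p c + m11 * p1 c"
    using volterra_sol_exists[of c b _ "\<lambda>_. 0" "m00 * p c + m01 * p1 c" "m10 * p c + m11 * p1 c", OF _ Qr_cont] cb by auto
  have t: "tau3 (p c) (p1 c) (r c) (r1 c) = 0 \<and> tau4 (p c) (p1 c) (r c) (r1 c) = 0"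
    unfolding m using r by simp
  have "boundary_form (r b) (r1 b) \<noteq> 0"
  proof
    assume "boundary_form (r b) (r1 b) = 0"
    then have "bvp (\<lambda>_. 0) (\<lambda>_. 0) 0 p p1 r r1"
      unfolding bvp_def boundary_form_def[symmetric] using p r t by (simp add: algebra_simps)
    from bvp_homogeneous_zero[OF this] show False using p a1 by simp
  qed
  then show thesis using that p r t by blast
qed

lemma bvp_exists:
  assumes "gl integrable_on {a..c}" "gr integrable_on {c..b}"
  obtains u u1 v v1 where "bvp gl gr g1 u u1 v v1"
proof -
  obtain m00 m01 m10 m11 where m: "\<And>y z y' z'. tau3 y z y' z' = 0 \<and> tau4 y z y' z' = 0 \<longleftrightarrow>
     y' = m00 * y + m01 * z \<and> z' = m10 * y + m11 * z"
    by (rule transmission) blast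
  obtain p p1 r r1 where pr: "sol_l (\<lambda>_. 0) p p1" "sol_r (\<lambda>_. 0) r r1" "p a = of_real a11" "p1 a = - of_real a10"
    "tau3 (p c) (p1 c) (r c) (r1 c) = 0" "tau4 (p c) (p1 c) (r c) (r1 c) = 0" and om: "boundary_form (r b) (r1 b) \<noteq> 0"
    by (rule fundamental_solution)
  obtain u u1 where u: "sol_l gl u u1" "u a = 0" "u1 a = 0"
    using volterra_sol_exists[of a c _ gl 0 0, OF _ Ql_cont assms(1)] ac by auto
  obtain v v1 where v: "sol_r gr v v1" "v c = m00 * u c + m01 * u1 c" "v1 c = m10 * u c + m11 * u1 c"
    using volterra_sol_exists[of c b _ gr "m00 * u c + m01 * u1 c" "m10 * u c + m11 * u1 c", OF _ Qr_cont assms(2)] cb by auto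
  define \<omega> where "\<omega> = boundary_form (r b) (r1 b)"
  \<comment> \<open>The particular solution starts with zero data at \<open>a\<close> and so
    satisfies all conditions but the last; this multiple of the fundamental solution corrects its
    boundary form to \<open>g1\<close>.\<close>
  define k where "k = (g1 - boundary_form (v b) (v1 b)) / \<omega>"
  have bu: "bvp gl gr (boundary_form (v b) (v1 b)) u u1 v v1"
    unfolding bvp_def boundary_form_def[symmetric] using u v m[of "u c" "u1 c" "v c" "v1 c"] by simp
  have bp: "bvp (\<lambda>_. 0) (\<lambda>_. 0) \<omega> p p1 r r1"
    unfolding bvp_def boundary_form_def[symmetric] using pr by (simp add: \<omega>_def)
  have "boundary_form (v b) (v1 b) + k * \<omega> = g1" using om by (simp add: k_def \<omega>_def)
  with bvp_add_mult[OF bu bp, of k] show thesis using that by simp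
qed

text \<open>The estimate holds for every solution, not just a constructed one, so zero data give
  uniqueness as well. A multiple \<open>k\<close> of the fundamental solution is subtracted to make
  the data at \<open>a\<close> zero; the remainder is bounded interval by interval, and
  \<open>k\<close> by dividing the last condition by \<open>\<omega>\<close>.\<close>

lemma bvp_bound:
  obtains K where "K \<ge> 0"
    "\<And>gl gr g1 u u1 v v1. \<lbrakk>bvp gl gr g1 u u1 v v1; gl absolutely_integrable_on {a..c}; gr absolutely_integrable_on {c..b}\<rbrakk> \<Longrightarrow>
       (\<forall>x\<in>{a..c}. cmod (u x) + cmod (u1 x) \<le> K * data_size gl gr g1) \<and>
       (\<forall>x\<in>{c..b}. cmod (v x) + cmod (v1 x) \<le> K * data_size gl gr g1)"
proof -
  obtain m00 m01 m10 m11 where m: "\<And>y z y' z'. tau3 y z y' z' = 0 \<and> tau4 y z y' z' = 0 \<longleftrightarrow>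
     y' = m00 * y + m01 * z \<and> z' = m10 * y + m11 * z"
    by (rule transmission) blast
  obtain p p1 r r1 where pr: "sol_l (\<lambda>_. 0) p p1" "sol_r (\<lambda>_. 0) r r1" "p a = of_real a11" "p1 a = - of_real a10"
    "tau3 (p c) (p1 c) (r c) (r1 c) = 0" "tau4 (p c) (p1 c) (r c) (r1 c) = 0" and om: "boundary_form (r b) (r1 b) \<noteq> 0"
    by (rule fundamental_solution)
  obtain Kl where Kl: "Kl \<ge> 0" "\<And>g u w x. \<lbrakk>sol_l g u w; g absolutely_integrable_on {a..c}; x \<in> {a..c}\<rbrakk>
     \<Longrightarrow> norm (u x) + norm (w x) \<le> Kl * (norm (u a) + norm (w a) + integral {a..c} (\<lambda>y. norm (g y)))"
    using volterra_sol_bound[OF _ Ql_cont] ac by (metis less_imp_le)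
  obtain Kr where Kr: "Kr \<ge> 0" "\<And>g u w x. \<lbrakk>sol_r g u w; g absolutely_integrable_on {c..b}; x \<in> {c..b}\<rbrakk>
     \<Longrightarrow> norm (u x) + norm (w x) \<le> Kr * (norm (u c) + norm (w c) + integral {c..b} (\<lambda>y. norm (g y)))"
    using volterra_sol_bound[OF _ Qr_cont] cb by (metis less_imp_le)
  define M where "M = cmod m00 + cmod m01 + cmod m10 + cmod m11"
  define B where "B = cmod (boundary_form 1 0) + cmod (boundary_form 0 1)"
  define \<omega> where "\<omega> = boundary_form (r b) (r1 b)"
  \<comment> \<open>\<open>K2\<close> bounds the remainder on the right: the left bound
    \<open>Kl\<close> passes through the transmission coefficients \<open>M\<close>, then through
    \<open>Kr\<close>. \<open>K3\<close> bounds \<open>k\<close> by way of the boundary form, and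
    \<open>P1\<close>, \<open>P2\<close> bound the fundamental solution.\<close>
  define K2 where "K2 = Kr * (M * Kl + 1)"
  define K3 where "K3 = (1 + B * K2) / cmod \<omega>"
  define P1 where "P1 = Kl * (cmod (p a) + cmod (p1 a))"
  define P2 where "P2 = Kr * (cmod (r c) + cmod (r1 c))"
  have nn: "M \<ge> 0" "B \<ge> 0" "P1 \<ge> 0" "P2 \<ge> 0" using Kl Kr by (auto simp: M_def B_def P1_def P2_def)
  then have K2: "K2 \<ge> 0" using Kl Kr by (simp add: K2_def)
  then have K3: "K3 \<ge> 0" using nn by (simp add: K3_def)
  have P1: "cmod (p x) + cmod (p1 x) \<le> P1" if "x \<in> {a..c}" for x
    using Kl(2)[OF pr(1) _ that] by (simp add: P1_def)
  have P2: "cmod (r x) + cmod (r1 x) \<le> P2" if "x \<in> {c..b}" for x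
    using Kr(2)[OF pr(2) _ that] by (simp add: P2_def)
  show thesis
  proof (rule that)
    show "(Kl + K3 * P1) + (K2 + K3 * P2) \<ge> 0" using nn K2 K3 Kl Kr by simp
    fix gl gr g1 u u1 v v1
    assume bvp: "bvp gl gr g1 u u1 v v1"
      and gl: "gl absolutely_integrable_on {a..c}" and gr: "gr absolutely_integrable_on {c..b}"
    define Nl where "Nl = integral {a..c} (\<lambda>x. cmod (gl x))"
    define Nr where "Nr = integral {c..b} (\<lambda>x. cmod (gr x))"
    have N: "Nl \<ge> 0" "Nr \<ge> 0" unfolding Nl_def Nr_def
      using gl gr by (auto intro!: Henstock_Kurzweil_Integration.integral_nonneg simp: absolutely_integrable_on_def)
    define S where "S = Nl + Nr + cmod g1"
    have S: "S \<ge> 0" "Nl \<le> S" "Nr \<le> S" "cmod g1 \<le> S" using N by (auto simp: S_def)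
    \<comment> \<open>The coefficient of the orthogonal projection of \<open>(u a, u1 a)\<close>
      onto \<open>(a11, - a10)\<close>. The condition at \<open>a\<close> says that the two vectors
      are parallel, so the projection is the whole vector.\<close>
    define k where "k = (of_real a11 * u a - of_real a10 * u1 a) / of_real (a10\<^sup>2 + a11\<^sup>2)"
    have "a10\<^sup>2 + a11\<^sup>2 \<noteq> 0" using a1 by (simp add: sum_power2_eq_zero_iff)
    then have d: "complex_of_real (a10\<^sup>2 + a11\<^sup>2) \<noteq> 0" unfolding of_real_eq_0_iff .
    have ba: "of_real a10 * u a + of_real a11 * u1 a = 0" using bvp by (simp add: bvp_def)
    have "of_real (a10\<^sup>2 + a11\<^sup>2) * u a = of_real a11 * (of_real a11 * u a - of_real a10 * u1 a) + of_real a10 * (of_real a10 * u a + of_real a11 * u1 a)"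
      by (simp add: algebra_simps power2_eq_square)
    then have ka: "u a = k * of_real a11" using d ba by (simp add: k_def field_simps)
    have "of_real (a10\<^sup>2 + a11\<^sup>2) * u1 a = - of_real a10 * (of_real a11 * u a - of_real a10 * u1 a) + of_real a11 * (of_real a10 * u a + of_real a11 * u1 a)"
      by (simp add: algebra_simps power2_eq_square)
    then have ka1: "u1 a = - k * of_real a10" using d ba by (simp add: k_def field_simps)
    have bp: "bvp (\<lambda>_. 0) (\<lambda>_. 0) \<omega> p p1 r r1"
      unfolding bvp_def boundary_form_def[symmetric] using pr by (simp add: \<omega>_def)
    let ?u = "\<lambda>x. u x + - k * p x" and ?u1 = "\<lambda>x. u1 x + - k * p1 x"
      and ?v = "\<lambda>x. v x + - k * r x" and ?v1 = "\<lambda>x. v1 x + - k * r1 x"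
    have h: "bvp gl gr (g1 + - k * \<omega>) ?u ?u1 ?v ?v1"
      using bvp_add_mult[OF bvp bp, of "- k"] by simp
    have ul: "cmod (?u x) + cmod (?u1 x) \<le> Kl * S" if "x \<in> {a..c}" for x
    proof -
      have "cmod (?u x) + cmod (?u1 x) \<le> Kl * (cmod (?u a) + cmod (?u1 a) + Nl)"
        unfolding Nl_def by (rule Kl(2)[OF _ gl that]) (use h in \<open>simp add: bvp_def\<close>)
      also have "\<dots> = Kl * Nl" by (simp add: ka ka1 pr)
      also have "\<dots> \<le> Kl * S" using S Kl by (intro mult_left_mono) auto
      finally show ?thesis .
    qed
    have vc: "?v c = m00 * ?u c + m01 * ?u1 c \<and> ?v1 c = m10 * ?u c + m11 * ?u1 c"
      unfolding m[symmetric] using h by (simp add: bvp_def)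
    have vr: "cmod (?v x) + cmod (?v1 x) \<le> K2 * S" if "x \<in> {c..b}" for x
    proof -
      have "cmod (?v c) \<le> cmod m00 * cmod (?u c) + cmod m01 * cmod (?u1 c)"
        unfolding vc[THEN conjunct1] by (metis norm_mult norm_triangle_ineq)
      moreover have "cmod (?v1 c) \<le> cmod m10 * cmod (?u c) + cmod m11 * cmod (?u1 c)"
        unfolding vc[THEN conjunct2] by (metis norm_mult norm_triangle_ineq)
      moreover have "cmod m00 * cmod (?u c) + cmod m01 * cmod (?u1 c) + (cmod m10 * cmod (?u c) + cmod m11 * cmod (?u1 c))
         \<le> M * (cmod (?u c) + cmod (?u1 c))"
        by (simp add: M_def algebra_simps add_increasing)
      moreover have "M * (cmod (?u c) + cmod (?u1 c)) \<le> M * (Kl * S)"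
        using ul[of c] ac nn by (intro mult_left_mono) auto
      ultimately have i: "cmod (?v c) + cmod (?v1 c) \<le> M * (Kl * S)" by linarith
      have "cmod (?v x) + cmod (?v1 x) \<le> Kr * (cmod (?v c) + cmod (?v1 c) + Nr)"
        unfolding Nr_def by (rule Kr(2)[OF _ gr that]) (use h in \<open>simp add: bvp_def\<close>)
      also have "\<dots> \<le> Kr * (M * (Kl * S) + S)"
        using i S Kr by (intro mult_left_mono add_mono) auto
      also have "\<dots> = K2 * S" by (simp add: K2_def algebra_simps)
      finally show ?thesis .
    qed
    have "k * \<omega> = g1 - boundary_form (?v b) (?v1 b)" using h by (simp add: bvp_def boundary_form_def[symmetric])
    then have "cmod k * cmod \<omega> \<le> cmod g1 + cmod (boundary_form (?v b) (?v1 b))"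
      by (metis norm_mult norm_triangle_ineq4)
    also have "\<dots> \<le> S + B * (K2 * S)"
    proof -
      have "cmod (boundary_form (?v b) (?v1 b)) \<le> B * (cmod (?v b) + cmod (?v1 b))"
        unfolding B_def by (rule boundary_form_bound)
      also have "\<dots> \<le> B * (K2 * S)" using vr[of b] cb nn by (intro mult_left_mono) auto
      finally show ?thesis using S by simp
    qed
    finally have k: "cmod k \<le> K3 * S"
      using om by (simp add: K3_def \<omega>_def field_simps)
    have tri: "cmod x + cmod y \<le> cmod (x + - k * x') + cmod (y + - k * y') + cmod k * (cmod x' + cmod y')" for x y x' y'
    proof -
      have "cmod z \<le> cmod (z + - k * z') + cmod (k * z')" for z z'
        using norm_triangle_ineq[of "z + - k * z'" "k * z'"] by simp
      from this[of x x'] this[of y y'] show ?thesis unfolding norm_mult by (simp only: distrib_left)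
    qed
    have "cmod (u x) + cmod (u1 x) \<le> ((Kl + K3 * P1) + (K2 + K3 * P2)) * S" if x: "x \<in> {a..c}" for x
    proof -
      have "cmod k * (cmod (p x) + cmod (p1 x)) \<le> K3 * S * P1"
        using k P1[OF x] S K3 by (intro mult_mono) auto
      then have "cmod (u x) + cmod (u1 x) \<le> (Kl + K3 * P1) * S"
        using tri[of "u x" "u1 x" "p x" "p1 x"] ul[OF x] by (simp add: algebra_simps)
      also have "\<dots> \<le> ((Kl + K3 * P1) + (K2 + K3 * P2)) * S"
        using S nn K2 K3 by (intro mult_right_mono) auto
      finally show ?thesis .
    qed
    moreover have "cmod (v x) + cmod (v1 x) \<le> ((Kl + K3 * P1) + (K2 + K3 * P2)) * S" if x: "x \<in> {c..b}" for x
    proof -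
      have "cmod k * (cmod (r x) + cmod (r1 x)) \<le> K3 * S * P2"
        using k P2[OF x] S K3 by (intro mult_mono) auto
      then have "cmod (v x) + cmod (v1 x) \<le> (K2 + K3 * P2) * S"
        using tri[of "v x" "v1 x" "r x" "r1 x"] vr[OF x] by (simp add: algebra_simps)
      also have "\<dots> \<le> ((Kl + K3 * P1) + (K2 + K3 * P2)) * S"
        using S nn Kl K3 by (intro mult_right_mono) auto
      finally show ?thesis .
    qed
    ultimately show "(\<forall>x\<in>{a..c}. cmod (u x) + cmod (u1 x) \<le> ((Kl + K3 * P1) + (K2 + K3 * P2)) * data_size gl gr g1) \<and>
       (\<forall>x\<in>{c..b}. cmod (v x) + cmod (v1 x) \<le> ((Kl + K3 * P1) + (K2 + K3 * P2)) * data_size gl gr g1)"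
      by (simp add: S_def Nl_def Nr_def)
  qed
qed

subsection \<open>The resolvent\<close>

abbreviation "LA \<equiv> lam_minus_A a c b q a10 a11 a20 a21 a20' a21' bm10 bm11 bm20 bm21 bp10 bp11 bp20 bp21 lam"
abbreviation "nrm \<equiv> H1_norm a c b D12 D34 D0"

text \<open>\<open>G\<close> matters only up to null sets, whereas \<open>hl F\<close> and
  \<open>hr F\<close> satisfy the integral equations at every point of the closed intervals; their
  values at \<open>a\<close>, \<open>c\<close> and \<open>b\<close> are therefore
  meaningful.\<close>

lemma LA_imp_bvp:
  assumes "LA F G"
  obtains u1 v1 where "bvp (hl G) (hr G) (hc G) (hl F) u1 (hr F) v1" "hc F = Tb' (hr F b) (v1 b)"
    "in_H1 a c b F"
proof -
  obtain AF where A: "A_graph a c b q a10 a11 a20 a21 a20' a21' bm10 bm11 bm20 bm21 bp10 bp11 bp20 bp21 F AF"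
    and eq: "H1_eq a c b (H1_diff (H1_scale lam F) AF) G"
    using assms by (auto simp: lam_minus_A_def)
  from A obtain u1 u2 v1 v2 where inH: "in_H1 a c b F"
    and du: "\<And>x. x \<in> {a..c} \<Longrightarrow> (hl F has_vector_derivative u1 x) (at x within {a..c})"
    and dv: "\<And>x. x \<in> {c..b} \<Longrightarrow> (hr F has_vector_derivative v1 x) (at x within {c..b})"
    and acu: "ac_on a c u1" and acv: "ac_on c b v1"
    and u2: "AE x in lebesgue. x \<in> {a<..<c} \<longrightarrow> (u1 has_vector_derivative u2 x) (at x)"
    and v2: "AE x in lebesgue. x \<in> {c<..<b} \<longrightarrow> (v1 has_vector_derivative v2 x) (at x)"
    and t1: "complex_of_real a10 * hl F a + complex_of_real a11 * u1 a = 0"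
    and t3: "complex_of_real bm11 * u1 c + complex_of_real bm10 * hl F c
          + complex_of_real bp11 * v1 c + complex_of_real bp10 * hr F c = 0"
    and t4: "complex_of_real bm21 * u1 c + complex_of_real bm20 * hl F c
          + complex_of_real bp21 * v1 c + complex_of_real bp20 * hr F c = 0"
    and hc: "hc F = complex_of_real a20' * hr F b - complex_of_real a21' * v1 b"
    and Al: "AE x in lebesgue. x \<in> {a<..<c} \<longrightarrow> hl AF x = - u2 x + complex_of_real (q x) * hl F x"
    and Ar: "AE x in lebesgue. x \<in> {c<..<b} \<longrightarrow> hr AF x = - v2 x + complex_of_real (q x) * hr F x"
    and Ac: "hc AF = - (complex_of_real a20 * hr F b - complex_of_real a21 * v1 b)"
    unfolding A_graph_def by blast
  from eq have el: "AE x in lebesgue. x \<in> {a<..<c} \<longrightarrow> lam * hl F x - hl AF x = hl G x"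
    and er: "AE x in lebesgue. x \<in> {c<..<b} \<longrightarrow> lam * hr F x - hr AF x = hr G x"
    and ec: "lam * hc F - hc AF = hc G"
    by (simp_all add: H1_eq_def H1_diff_def H1_scale_def)
  have "sol_l (hl G) (hl F) u1"
  proof (rule volterra_solI[OF _ du acu u2])
    show "AE x in lebesgue. x \<in> {a<..<c} \<longrightarrow> u2 x = (complex_of_real (ql x) - lam) * hl F x + hl G x"
      using Al el
    proof eventually_elim
      case (elim x)
      show ?case
      proof
        assume x: "x \<in> {a<..<c}"
        then have "hl G x = lam * hl F x - (- u2 x + complex_of_real (q x) * hl F x)" using elim by simp
        moreover have "ql x = q x" using x by (simp add: ql_def)
        ultimately show "u2 x = (complex_of_real (ql x) - lam) * hl F x + hl G x"
          by (simp add: algebra_simps)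
      qed
    qed
  qed (use ac in simp)
  moreover have "sol_r (hr G) (hr F) v1"
  proof (rule volterra_solI[OF _ dv acv v2])
    show "AE x in lebesgue. x \<in> {c<..<b} \<longrightarrow> v2 x = (complex_of_real (qr x) - lam) * hr F x + hr G x"
      using Ar er
    proof eventually_elim
      case (elim x)
      show ?case
      proof
        assume x: "x \<in> {c<..<b}"
        then have "hr G x = lam * hr F x - (- v2 x + complex_of_real (q x) * hr F x)" using elim by simp
        moreover have "qr x = q x" using x by (simp add: qr_def)
        ultimately show "v2 x = (complex_of_real (qr x) - lam) * hr F x + hr G x"
          by (simp add: algebra_simps)
      qed
    qed
  qed (use cb in simp)
  moreover have "lam * Tb' (hr F b) (v1 b) + Tb (hr F b) (v1 b) = hc G"
    unfolding ec[symmetric] hc Ac Tb_def Tb'_def by simp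
  ultimately have "bvp (hl G) (hr G) (hc G) (hl F) u1 (hr F) v1"
    using t1 t3 t4 by (simp add: bvp_def tau3_def tau4_def)
  moreover have "hc F = Tb' (hr F b) (v1 b)" using hc by (simp add: Tb'_def)
  ultimately show thesis using that inH by blast
qed

lemma bvp_imp_LA:
  assumes bvp: "bvp (hl G) (hr G) (hc G) u u1 v v1" and G: "in_H1 a c b G"
  shows "LA \<lparr>hl = u, hr = v, hc = Tb' (v b) (v1 b)\<rparr> G"
proof -
  let ?F = "\<lparr>hl = u, hr = v, hc = Tb' (v b) (v1 b)\<rparr>"
  have sl: "sol_l (hl G) u u1" and sr: "sol_r (hr G) v v1"
    and ba: "of_real a10 * u a + of_real a11 * u1 a = 0"
    and t3: "tau3 (u c) (u1 c) (v c) (v1 c) = 0" and t4: "tau4 (u c) (u1 c) (v c) (v1 c) = 0"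
    and bb: "lam * Tb' (v b) (v1 b) + Tb (v b) (v1 b) = hc G"
    using bvp by (auto simp: bvp_def)
  have Gl: "L2_on {a<..<c} (hl G)" and Gr: "L2_on {c<..<b} (hr G)" using G by (auto simp: in_H1_def)
  have cu: "continuous_on {a..c} u" and cv: "continuous_on {c..b} v"
    using sl sr by (auto simp: volterra_sol_def)
  note regl = volterra_sol_regular[OF less_imp_le[OF ac] sl Ql_cont L2_on_absolutely_integrable[OF Gl]]
  note regr = volterra_sol_regular[OF less_imp_le[OF cb] sr Qr_cont L2_on_absolutely_integrable[OF Gr]]
  let ?u2 = "\<lambda>x. (complex_of_real (ql x) - lam) * u x + hl G x"
  let ?v2 = "\<lambda>x. (complex_of_real (qr x) - lam) * v x + hr G x"
  have el: "lam * u x - hl G x = - ?u2 x + complex_of_real (q x) * u x" if "x \<in> {a<..<c}" for x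
    using that by (simp add: ql_def algebra_simps)
  have er: "lam * v x - hr G x = - ?v2 x + complex_of_real (q x) * v x" if "x \<in> {c<..<b}" for x
    using that by (simp add: qr_def algebra_simps)
  \<comment> \<open>Square integrability of \<open>\<L>f\<close> is read off from
    \<open>\<L>f = lam * f - g\<close>, with \<open>f\<close> continuous and \<open>g\<close> in
    \<open>L\<^sup>2\<close>.\<close>
  have "L2_on {a<..<c} (\<lambda>x. lam * u x - hl G x)"
    by (intro L2_on_diff L2_on_continuous continuous_intros cu Gl) simp
  then have Ll: "L2_on {a<..<c} (\<lambda>x. - ?u2 x + complex_of_real (q x) * u x)" using el by (rule L2_on_cong)
  have "L2_on {c<..<b} (\<lambda>x. lam * v x - hr G x)"
    by (intro L2_on_diff L2_on_continuous continuous_intros cv Gr) simp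
  then have Lr: "L2_on {c<..<b} (\<lambda>x. - ?v2 x + complex_of_real (q x) * v x)" using er by (rule L2_on_cong)
  \<comment> \<open>With this choice the resolvent equation holds by construction, and what remains
    is to recognise \<open>AF\<close> as the image of \<open>?F\<close> under
    \<open>A\<close>.\<close>
  define AF where "AF = H1_diff (H1_scale lam ?F) G"
  have AF: "hl AF = (\<lambda>x. lam * u x - hl G x)" "hr AF = (\<lambda>x. lam * v x - hr G x)"
    "hc AF = - Tb (v b) (v1 b)"
    by (simp_all add: AF_def H1_diff_def H1_scale_def bb[symmetric])
  have inF: "in_H1 a c b ?F" using L2_on_continuous[OF cu] L2_on_continuous[OF cv] by (simp add: in_H1_def)
  have "A_graph a c b q a10 a11 a20 a21 a20' a21' bm10 bm11 bm20 bm21 bp10 bp11 bp20 bp21 ?F AF"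
    unfolding A_graph_def
  proof (rule conjI[OF inF], rule exI[of _ u1], rule exI[of _ ?u2], rule exI[of _ v1], rule exI[of _ ?v2], intro conjI)
    show "\<forall>x\<in>{a..c}. (hl ?F has_vector_derivative u1 x) (at x within {a..c})"
      using volterra_sol_deriv[OF sl] by simp
    show "\<forall>x\<in>{c..b}. (hr ?F has_vector_derivative v1 x) (at x within {c..b})"
      using volterra_sol_deriv[OF sr] by simp
    show "ac_on a c (hl ?F)" "ac_on a c u1" "ac_on c b (hr ?F)" "ac_on c b v1"
      using regl regr by simp_all
    show "AE x in lebesgue. x \<in> {a<..<c} \<longrightarrow> (u1 has_vector_derivative ?u2 x) (at x)" by (rule regl(3))
    show "AE x in lebesgue. x \<in> {c<..<b} \<longrightarrow> (v1 has_vector_derivative ?v2 x) (at x)" by (rule regr(3))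
    show "L2_on {a<..<c} (\<lambda>x. - ?u2 x + complex_of_real (q x) * hl ?F x)" using Ll by simp
    show "L2_on {c<..<b} (\<lambda>x. - ?v2 x + complex_of_real (q x) * hr ?F x)" using Lr by simp
    show "complex_of_real a10 * hl ?F a + complex_of_real a11 * u1 a = 0" using ba by simp
    show "complex_of_real bm11 * u1 c + complex_of_real bm10 * hl ?F c
          + complex_of_real bp11 * v1 c + complex_of_real bp10 * hr ?F c = 0" using t3 by (simp add: tau3_def)
    show "complex_of_real bm21 * u1 c + complex_of_real bm20 * hl ?F c
          + complex_of_real bp21 * v1 c + complex_of_real bp20 * hr ?F c = 0" using t4 by (simp add: tau4_def)
    show "hc ?F = complex_of_real a20' * hr ?F b - complex_of_real a21' * v1 b" by (simp add: Tb'_def)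
    show "AE x in lebesgue. x \<in> {a<..<c} \<longrightarrow> hl AF x = - ?u2 x + complex_of_real (q x) * hl ?F x"
      using el unfolding AF by (intro AE_I2) simp
    show "AE x in lebesgue. x \<in> {c<..<b} \<longrightarrow> hr AF x = - ?v2 x + complex_of_real (q x) * hr ?F x"
      using er unfolding AF by (intro AE_I2) simp
    show "hc AF = - (complex_of_real a20 * hr ?F b - complex_of_real a21 * v1 b)"
      unfolding AF by (simp add: Tb_def)
  qed
  moreover have "H1_eq a c b (H1_diff (H1_scale lam ?F) AF) G"
    by (simp add: H1_eq_def H1_diff_def H1_scale_def AF_def)
  ultimately show ?thesis unfolding lam_minus_A_def by blast
qed

section \<open>Bijectivity of \<open>lam - A\<close>\<close>

lemma LA_surj:
  assumes G: "in_H1 a c b G"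
  shows "\<exists>F. LA F G"
proof -
  have "hl G integrable_on {a..c}" "hr G integrable_on {c..b}"
    using G L2_on_absolutely_integrable by (auto simp: in_H1_def absolutely_integrable_on_def)
  then obtain u u1 v v1 where "bvp (hl G) (hr G) (hc G) u u1 v v1" by (rule bvp_exists)
  then show ?thesis using bvp_imp_LA[OF _ G] by blast
qed

text \<open>The a priori estimate with data of size 0. The vanishing of \<open>v1\<close> is
  recorded because the third component of an element of the domain involves the derivative at
  \<open>b\<close>.\<close>

lemma bvp_zero:
  assumes "bvp (\<lambda>_. 0) (\<lambda>_. 0) 0 u u1 v v1"
  shows "\<forall>x\<in>{a..c}. u x = 0" "\<forall>x\<in>{c..b}. v x = 0 \<and> v1 x = 0"
proof -
  obtain K where K: "\<And>gl gr g1 u u1 v v1. \<lbrakk>bvp gl gr g1 u u1 v v1; gl absolutely_integrable_on {a..c}; gr absolutely_integrable_on {c..b}\<rbrakk> \<Longrightarrow>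
       (\<forall>x\<in>{a..c}. cmod (u x) + cmod (u1 x) \<le> K * data_size gl gr g1) \<and>
       (\<forall>x\<in>{c..b}. cmod (v x) + cmod (v1 x) \<le> K * data_size gl gr g1)"
    by (rule bvp_bound) blast
  have K': "(\<forall>x\<in>{a..c}. cmod (u x) + cmod (u1 x) \<le> 0) \<and> (\<forall>x\<in>{c..b}. cmod (v x) + cmod (v1 x) \<le> 0)"
    using K[OF assms] by simp
  then show "\<forall>x\<in>{a..c}. u x = 0"
    by (metis add_nonneg_eq_0_iff norm_eq_zero norm_ge_zero antisym add_nonneg_nonneg)
  show "\<forall>x\<in>{c..b}. v x = 0 \<and> v1 x = 0"
    using K' by (metis add_nonneg_eq_0_iff norm_eq_zero norm_ge_zero antisym add_nonneg_nonneg)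
qed

lemma LA_inj:
  assumes "LA F G" "LA F' G'" "H1_eq a c b G G'"
  shows "H1_eq a c b F F'"
proof -
  obtain u1 v1 where F: "bvp (hl G) (hr G) (hc G) (hl F) u1 (hr F) v1" "hc F = Tb' (hr F b) (v1 b)"
    using LA_imp_bvp[OF assms(1)] by blast
  obtain u1' v1' where F': "bvp (hl G') (hr G') (hc G') (hl F') u1' (hr F') v1'" "hc F' = Tb' (hr F' b) (v1' b)"
    using LA_imp_bvp[OF assms(2)] by blast
  note d = bvp_add_mult[OF F(1) F'(1), of "- 1"]
  let ?u = "\<lambda>x. hl F x + - 1 * hl F' x" and ?u1 = "\<lambda>x. u1 x + - 1 * u1' x"
    and ?v = "\<lambda>x. hr F x + - 1 * hr F' x" and ?v1 = "\<lambda>x. v1 x + - 1 * v1' x"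
  have "sol_l (\<lambda>x. hl G x + - 1 * hl G' x) ?u ?u1" using d by (simp only: bvp_def)
  \<comment> \<open>The difference of the data vanishes only almost everywhere; the integrated form
    allows it to be replaced by the zero function.\<close>
  then have l: "sol_l (\<lambda>_. 0) ?u ?u1"
  proof (rule volterra_sol_spike)
    have "AE x in lebesgue. x \<in> {a<..<c} \<longrightarrow> hl G x = hl G' x" using assms(3) by (simp add: H1_eq_def)
    then show "AE x in lebesgue. x \<in> {a<..<c} \<longrightarrow> (complex_of_real (ql x) - lam) * ?u x + (hl G x + - 1 * hl G' x)
       = (complex_of_real (ql x) - lam) * ?u x + 0"
      by (rule eventually_mono) simp
  qed
  have "sol_r (\<lambda>x. hr G x + - 1 * hr G' x) ?v ?v1" using d by (simp only: bvp_def)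
  then have r: "sol_r (\<lambda>_. 0) ?v ?v1"
  proof (rule volterra_sol_spike)
    have "AE x in lebesgue. x \<in> {c<..<b} \<longrightarrow> hr G x = hr G' x" using assms(3) by (simp add: H1_eq_def)
    then show "AE x in lebesgue. x \<in> {c<..<b} \<longrightarrow> (complex_of_real (qr x) - lam) * ?v x + (hr G x + - 1 * hr G' x)
       = (complex_of_real (qr x) - lam) * ?v x + 0"
      by (rule eventually_mono) simp
  qed
  have "hc G + - 1 * hc G' = 0" using assms(3) by (simp add: H1_eq_def)
  with d l r have "bvp (\<lambda>_. 0) (\<lambda>_. 0) 0 ?u ?u1 ?v ?v1"
    unfolding bvp_def by simp
  note z = bvp_zero[OF this]
  have "hl F x = hl F' x" if "x \<in> {a<..<c}" for x
    using z(1) that by simp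
  moreover have "hr F x = hr F' x" if "x \<in> {c<..<b}" for x
    using z(2) that by simp
  moreover have "hc F = hc F'"
    using z(2) cb by (simp add: F F')
  ultimately show ?thesis by (simp add: H1_eq_def)
qed

section \<open>Uniform estimate, boundedness and compactness\<close>

lemma nrm_nonneg: "nrm F \<ge> 0"
proof -
  have "0 \<le> nrm F / sqrt (D34 / D0)"
    using H1_norm_ge(3)[OF D12_pos D34_pos D0_pos] norm_ge_zero order_trans by blast
  moreover have "sqrt (D34 / D0) > 0" using D34_pos D0_pos by simp
  ultimately show ?thesis by (simp add: zero_le_divide_iff)
qed

text \<open>One constant controls the supremum, the third component and the Lipschitz constant; the
  last is a bound for the derivative. The first two give boundedness of the resolvent, and all of
  them together its compactness.\<close>

lemma LA_bound:
  obtains C where "C \<ge> 0" "\<And>F G. \<lbrakk>in_H1 a c b G; LA F G\<rbrakk> \<Longrightarrow>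
    (\<forall>x\<in>{a..c}. cmod (hl F x) \<le> C * nrm G) \<and> (\<forall>x\<in>{c..b}. cmod (hr F x) \<le> C * nrm G) \<and> cmod (hc F) \<le> C * nrm G \<and>
    (\<forall>x\<in>{a..c}. \<forall>y\<in>{a..c}. cmod (hl F x - hl F y) \<le> C * nrm G * \<bar>x - y\<bar>) \<and>
    (\<forall>x\<in>{c..b}. \<forall>y\<in>{c..b}. cmod (hr F x - hr F y) \<le> C * nrm G * \<bar>x - y\<bar>)"
proof -
  obtain K where K0: "K \<ge> 0" and K: "\<And>gl gr g1 u u1 v v1. \<lbrakk>bvp gl gr g1 u u1 v v1; gl absolutely_integrable_on {a..c}; gr absolutely_integrable_on {c..b}\<rbrakk> \<Longrightarrow>
       (\<forall>x\<in>{a..c}. cmod (u x) + cmod (u1 x) \<le> K * data_size gl gr g1) \<and>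
       (\<forall>x\<in>{c..b}. cmod (v x) + cmod (v1 x) \<le> K * data_size gl gr g1)"
    by (rule bvp_bound) blast
  \<comment> \<open>Converts the \<open>L\<^sup>1\<close> size of the data into the norm of
    \<open>G\<close>, one summand for each component.\<close>
  define E where "E = (c - a + 1) / sqrt D12 + (b - c + 1) / sqrt D34 + 1 / sqrt (D34 / D0)"
  have E: "E \<ge> 0" using ac cb D12_pos D34_pos D0_pos by (simp add: E_def)
  define B where "B = \<bar>a20'\<bar> + \<bar>a21'\<bar>"
  have B: "B \<ge> 0" by (simp add: B_def)
  show thesis
  proof (rule that)
    \<comment> \<open>\<open>K * E\<close> bounds functions and derivatives, and \<open>B\<close>
      times it bounds \<open>T'_b\<close>; the factor \<open>1 + B\<close> covers both.\<close>
    show "K * E * (1 + B) \<ge> 0" using K0 E B by simp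
    fix F G assume G: "in_H1 a c b G" and "LA F G"
    then obtain u1 v1 where bvp: "bvp (hl G) (hr G) (hc G) (hl F) u1 (hr F) v1" and hc: "hc F = Tb' (hr F b) (v1 b)"
      using LA_imp_bvp by blast
    have Gl: "L2_on {a<..<c} (hl G)" and Gr: "L2_on {c<..<b} (hr G)" using G by (auto simp: in_H1_def)
    have "integral {a..c} (\<lambda>x. cmod (hl G x)) \<le> (c - a + 1) * sqrt (LINT x:{a<..<c}|lebesgue. (cmod (hl G x))\<^sup>2)"
      using L1_le_L2[OF _ Gl] ac by simp
    also have "\<dots> \<le> (c - a + 1) * (nrm G / sqrt D12)"
      using ac by (intro mult_left_mono H1_norm_ge(1) D12_pos D34_pos D0_pos) auto
    finally have l: "integral {a..c} (\<lambda>x. cmod (hl G x)) \<le> (c - a + 1) * (nrm G / sqrt D12)" .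
    have "integral {c..b} (\<lambda>x. cmod (hr G x)) \<le> (b - c + 1) * sqrt (LINT x:{c<..<b}|lebesgue. (cmod (hr G x))\<^sup>2)"
      using L1_le_L2[OF _ Gr] cb by simp
    also have "\<dots> \<le> (b - c + 1) * (nrm G / sqrt D34)"
      using cb by (intro mult_left_mono H1_norm_ge(2) D12_pos D34_pos D0_pos) auto
    finally have r: "integral {c..b} (\<lambda>x. cmod (hr G x)) \<le> (b - c + 1) * (nrm G / sqrt D34)" .
    have "integral {a..c} (\<lambda>x. cmod (hl G x)) + integral {c..b} (\<lambda>x. cmod (hr G x)) + cmod (hc G)
       \<le> (c - a + 1) * (nrm G / sqrt D12) + (b - c + 1) * (nrm G / sqrt D34) + nrm G / sqrt (D34 / D0)"
      by (intro add_mono l r H1_norm_ge(3) D12_pos D34_pos D0_pos)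
    also have "\<dots> = E * nrm G" by (simp add: E_def distrib_right)
    finally have "K * (integral {a..c} (\<lambda>x. cmod (hl G x)) + integral {c..b} (\<lambda>x. cmod (hr G x)) + cmod (hc G)) \<le> K * (E * nrm G)"
      using K0 by (rule mult_left_mono)
    then have b: "\<And>x. x \<in> {a..c} \<Longrightarrow> cmod (hl F x) + cmod (u1 x) \<le> K * E * nrm G"
      "\<And>x. x \<in> {c..b} \<Longrightarrow> cmod (hr F x) + cmod (v1 x) \<le> K * E * nrm G"
      using K[OF bvp L2_on_absolutely_integrable[OF Gl] L2_on_absolutely_integrable[OF Gr]]
      by (force simp: mult.assoc)+
    have KE: "K * E * nrm G \<ge> 0" using K0 E nrm_nonneg by simp
    have le: "K * E * nrm G \<le> K * E * (1 + B) * nrm G" "B * (K * E * nrm G) \<le> K * E * (1 + B) * nrm G"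
      using KE mult_nonneg_nonneg[OF B KE] by (simp_all add: algebra_simps)
    have b': "cmod (hl F x) \<le> K * E * (1 + B) * nrm G" "cmod (u1 x) \<le> K * E * (1 + B) * nrm G" if "x \<in> {a..c}" for x
      using b(1)[OF that] le(1) norm_ge_zero[of "hl F x"] norm_ge_zero[of "u1 x"] by linarith+
    have b'': "cmod (hr F x) \<le> K * E * (1 + B) * nrm G" "cmod (v1 x) \<le> K * E * (1 + B) * nrm G" if "x \<in> {c..b}" for x
      using b(2)[OF that] le(1) norm_ge_zero[of "hr F x"] norm_ge_zero[of "v1 x"] by linarith+
    have "cmod (hc F) \<le> \<bar>a20'\<bar> * cmod (hr F b) + \<bar>a21'\<bar> * cmod (v1 b)"
      unfolding hc Tb'_def using norm_triangle_ineq4[of "of_real a20' * hr F b" "of_real a21' * v1 b"]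
      by (simp add: norm_mult)
    also have "\<dots> \<le> B * (cmod (hr F b) + cmod (v1 b))" by (simp add: B_def algebra_simps)
    also have "\<dots> \<le> B * (K * E * nrm G)" using b(2)[of b] cb B by (intro mult_left_mono) auto
    finally have hcb: "cmod (hc F) \<le> K * E * (1 + B) * nrm G" using le(2) by linarith
    have "sol_l (hl G) (hl F) u1" "sol_r (hr G) (hr F) v1" using bvp by (auto simp: bvp_def)
    then show "(\<forall>x\<in>{a..c}. cmod (hl F x) \<le> K * E * (1 + B) * nrm G) \<and>
      (\<forall>x\<in>{c..b}. cmod (hr F x) \<le> K * E * (1 + B) * nrm G) \<and> cmod (hc F) \<le> K * E * (1 + B) * nrm G \<and>
      (\<forall>x\<in>{a..c}. \<forall>y\<in>{a..c}. cmod (hl F x - hl F y) \<le> K * E * (1 + B) * nrm G * \<bar>x - y\<bar>) \<and>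
      (\<forall>x\<in>{c..b}. \<forall>y\<in>{c..b}. cmod (hr F x - hr F y) \<le> K * E * (1 + B) * nrm G * \<bar>x - y\<bar>)"
      using b' b'' hcb volterra_sol_lipschitz[of a c _ _ "hl F" u1 "K * E * (1 + B) * nrm G"]
        volterra_sol_lipschitz[of c b _ _ "hr F" v1 "K * E * (1 + B) * nrm G"]
      by (intro conjI ballI) blast+
  qed
qed

lemma LA_bounded: "\<exists>C. \<forall>F G. in_H1 a c b G \<and> LA F G \<longrightarrow> nrm F \<le> C * nrm G"
proof -
  obtain C where C: "C \<ge> 0" "\<And>F G. \<lbrakk>in_H1 a c b G; LA F G\<rbrakk> \<Longrightarrow>
    (\<forall>x\<in>{a..c}. cmod (hl F x) \<le> C * nrm G) \<and> (\<forall>x\<in>{c..b}. cmod (hr F x) \<le> C * nrm G) \<and> cmod (hc F) \<le> C * nrm G \<and>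
    (\<forall>x\<in>{a..c}. \<forall>y\<in>{a..c}. cmod (hl F x - hl F y) \<le> C * nrm G * \<bar>x - y\<bar>) \<and>
    (\<forall>x\<in>{c..b}. \<forall>y\<in>{c..b}. cmod (hr F x - hr F y) \<le> C * nrm G * \<bar>x - y\<bar>)"
    by (rule LA_bound) blast
  show ?thesis
  proof (intro exI allI impI; elim conjE)
    fix F G assume G: "in_H1 a c b G" and LA: "LA F G"
    have "in_H1 a c b F" using LA_imp_bvp[OF LA] by blast
    then have "nrm F \<le> sqrt (D12 * (c - a) + D34 * (b - c) + D34 / D0) * (C * nrm G)"
      using C(2)[OF G LA] ac cb
      by (intro H1_norm_le D12_pos D34_pos D0_pos) auto
    then show "nrm F \<le> sqrt (D12 * (c - a) + D34 * (b - c) + D34 / D0) * C * nrm G" by (simp add: mult.assoc)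
  qed
qed

text \<open>Subsequences are extracted three times in succession: for the left functions and then
  the right ones by Arzela-Ascoli, and finally for the numbers by Bolzano-Weierstrass. The limit
  functions are continuous, hence square integrable; the limit is claimed to lie in
  \<open>H\<^sub>1\<close>, not in the domain of \<open>A\<close>.\<close>

lemma LA_compact:
  fixes Fs Gs :: "nat \<Rightarrow> H1el"
  assumes A: "\<And>n. in_H1 a c b (Gs n) \<and> nrm (Gs n) \<le> 1 \<and> LA (Fs n) (Gs n)"
  shows "\<exists>r F. strict_mono r \<and> in_H1 a c b F \<and> (\<lambda>n. nrm (H1_diff (Fs (r n)) F)) \<longlonglongrightarrow> 0"
proof -
  obtain C where C: "C \<ge> 0" "\<And>F G. \<lbrakk>in_H1 a c b G; LA F G\<rbrakk> \<Longrightarrow>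
    (\<forall>x\<in>{a..c}. cmod (hl F x) \<le> C * nrm G) \<and> (\<forall>x\<in>{c..b}. cmod (hr F x) \<le> C * nrm G) \<and> cmod (hc F) \<le> C * nrm G \<and>
    (\<forall>x\<in>{a..c}. \<forall>y\<in>{a..c}. cmod (hl F x - hl F y) \<le> C * nrm G * \<bar>x - y\<bar>) \<and>
    (\<forall>x\<in>{c..b}. \<forall>y\<in>{c..b}. cmod (hr F x - hr F y) \<le> C * nrm G * \<bar>x - y\<bar>)"
    by (rule LA_bound) blast
  have le: "C * nrm (Gs n) \<le> C" for n using A[of n] C(1) mult_left_le by blast
  have le': "C * nrm (Gs n) * \<bar>x - y\<bar> \<le> C * \<bar>x - y\<bar>" for n and x y :: real
    using le[of n] by (rule mult_right_mono) simp
  have cl: "cmod (hl (Fs n) x) \<le> C" if "x \<in> {a..c}" for n x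
    using C(2)[of "Gs n" "Fs n"] A[of n] that le[of n] order_trans by blast
  have cr: "cmod (hr (Fs n) x) \<le> C" if "x \<in> {c..b}" for n x
    using C(2)[of "Gs n" "Fs n"] A[of n] that le[of n] order_trans by blast
  have cc: "cmod (hc (Fs n)) \<le> C" for n
    using C(2)[of "Gs n" "Fs n"] A[of n] le[of n] order_trans by blast
  have ll: "cmod (hl (Fs n) x - hl (Fs n) y) \<le> C * \<bar>x - y\<bar>" if "x \<in> {a..c}" "y \<in> {a..c}" for n x y
    using C(2)[of "Gs n" "Fs n"] A[of n] that le'[of n x y] order_trans by blast
  have lr: "cmod (hr (Fs n) x - hr (Fs n) y) \<le> C * \<bar>x - y\<bar>" if "x \<in> {c..b}" "y \<in> {c..b}" for n x y
    using C(2)[of "Gs n" "Fs n"] A[of n] that le'[of n x y] order_trans by blast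
  have "\<exists>g k. continuous_on {a..c} g \<and> strict_mono (k :: nat \<Rightarrow> nat) \<and>
     (\<forall>e>0. \<exists>N. \<forall>n x. n \<ge> N \<and> x \<in> {a..c} \<longrightarrow> cmod (hl (Fs (k n)) x - g x) < e)"
    by (rule uniformly_lipschitz_convergent_subseq) (fact cl ll)+
  then obtain g and k :: "nat \<Rightarrow> nat" where g: "continuous_on {a..c} g" "strict_mono k"
    and gk: "\<forall>e>0. \<exists>N. \<forall>n x. n \<ge> N \<and> x \<in> {a..c} \<longrightarrow> cmod (hl (Fs (k n)) x - g x) < e"
    by blast
  have "\<exists>h k'. continuous_on {c..b} h \<and> strict_mono (k' :: nat \<Rightarrow> nat) \<and>
     (\<forall>e>0. \<exists>N. \<forall>n x. n \<ge> N \<and> x \<in> {c..b} \<longrightarrow> cmod (hr (Fs (k (k' n))) x - h x) < e)"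
    by (rule uniformly_lipschitz_convergent_subseq[where f = "\<lambda>n. hr (Fs (k n))"]) (fact cr lr)+
  then obtain h and k' :: "nat \<Rightarrow> nat" where h: "continuous_on {c..b} h" "strict_mono k'"
    and hk: "\<forall>e>0. \<exists>N. \<forall>n x. n \<ge> N \<and> x \<in> {c..b} \<longrightarrow> cmod (hr (Fs (k (k' n))) x - h x) < e"
    by blast
  have "bounded (range (\<lambda>n. hc (Fs (k (k' n)))))" using cc by (auto intro: boundedI)
  from bounded_imp_convergent_subsequence[OF this] obtain l k'' where k'': "strict_mono k''"
    and lk: "((\<lambda>n. hc (Fs (k (k' n)))) \<circ> k'') \<longlonglongrightarrow> l" by blast
  define r where "r n = k (k' (k'' n))" for n
  define F where "F = \<lparr>hl = g, hr = h, hc = l\<rparr>"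
  have inF: "in_H1 a c b F" using L2_on_continuous[OF g(1)] L2_on_continuous[OF h(1)] by (simp add: in_H1_def F_def)
  have inFs: "in_H1 a c b (Fs n)" for n using A[of n] LA_imp_bvp by blast
  have inD: "in_H1 a c b (H1_diff (Fs n) F)" for n
    using inF inFs[of n] by (auto simp: in_H1_def H1_diff_def intro!: L2_on_diff)
  define S where "S = sqrt (D12 * (c - a) + D34 * (b - c) + D34 / D0)"
  have S: "S \<ge> 0" using ac cb D12_pos D34_pos D0_pos by (simp add: S_def)
  have "(\<lambda>n. nrm (H1_diff (Fs (r n)) F)) \<longlonglongrightarrow> 0"
  proof (rule LIMSEQ_I)
    fix e :: real assume "e > 0"
    \<comment> \<open>Componentwise distance \<open>d\<close> gives norm distance
      \<open>S * d\<close>, which is below \<open>e\<close> even for \<open>S = 0\<close> thanks to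
      the summand 1.\<close>
    define d where "d = e / (S + 1)"
    have d: "d > 0" using \<open>e > 0\<close> S by (simp add: d_def)
    obtain N1 where N1: "\<And>n x. \<lbrakk>n \<ge> N1; x \<in> {a..c}\<rbrakk> \<Longrightarrow> cmod (hl (Fs (k n)) x - g x) < d" using gk d by meson
    obtain N2 where N2: "\<And>n x. \<lbrakk>n \<ge> N2; x \<in> {c..b}\<rbrakk> \<Longrightarrow> cmod (hr (Fs (k (k' n))) x - h x) < d" using hk d by meson
    obtain N3 where N3: "\<And>n. n \<ge> N3 \<Longrightarrow> cmod (hc (Fs (r n)) - l) < d"
      using LIMSEQ_D[OF lk d] by (auto simp: r_def)
    show "\<exists>no. \<forall>n\<ge>no. norm (nrm (H1_diff (Fs (r n)) F) - 0) < e"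
    proof (intro exI[of _ "max N1 (max N2 N3)"] allI impI)
      fix n assume n: "n \<ge> max N1 (max N2 N3)"
      \<comment> \<open>The three convergences are indexed at different stages of extraction: by
        \<open>k' (k'' n)\<close>, by \<open>k'' n\<close> and by \<open>n\<close>. Strictly
        increasing index maps dominate the identity, so one threshold on \<open>n\<close> serves all
        three.\<close>
      have kk: "k'' n \<ge> n" "k' (k'' n) \<ge> n"
        using seq_suble[OF k'', of n] seq_suble[OF h(2), of "k'' n"] by auto
      have "nrm (H1_diff (Fs (r n)) F) \<le> S * d"
        unfolding S_def
      proof (rule H1_norm_le)
        fix x assume "x \<in> {a<..<c}"
        then show "cmod (hl (H1_diff (Fs (r n)) F) x) \<le> d"
          using N1[of "k' (k'' n)" x] n kk by (simp add: H1_diff_def F_def r_def)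
      next
        fix x assume "x \<in> {c<..<b}"
        then show "cmod (hr (H1_diff (Fs (r n)) F) x) \<le> d"
          using N2[of "k'' n" x] n kk by (simp add: H1_diff_def F_def r_def)
      next
        show "cmod (hc (H1_diff (Fs (r n)) F)) \<le> d"
          using N3[of n] n by (simp add: H1_diff_def F_def)
      qed (use ac cb inD D12_pos D34_pos D0_pos in auto)
      also have "\<dots> < e" using \<open>e > 0\<close> S by (simp add: d_def field_simps)
      finally show "norm (nrm (H1_diff (Fs (r n)) F) - 0) < e" using nrm_nonneg by simp
    qed
  qed
  moreover have "strict_mono r"
    using g(2) h(2) k'' by (simp add: r_def strict_mono_def)
  ultimately show ?thesis using inF by blast
qed

end

theorem theorem1:
  fixes a c b :: real and q :: "real \<Rightarrow> real" and qcm qcp :: real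
    and a10 a11 a20 a21 a20' a21' :: real
    and bm10 bm11 bm20 bm21 bp10 bp11 bp20 bp21 :: real
    and lam :: complex
  defines "LA \<equiv> lam_minus_A a c b q a10 a11 a20 a21 a20' a21'
                   bm10 bm11 bm20 bm21 bp10 bp11 bp20 bp21 lam"
      and "nrm \<equiv> H1_norm a c b (Delta12 bm10 bm11 bm20 bm21) (Delta34 bp10 bp11 bp20 bp21)
                   (Delta0 a20 a21 a20' a21')"
  assumes "a < c" and "c < b"
    and "continuous_on {a..<c} q" and "continuous_on {c<..b} q"
    and "(q \<longlongrightarrow> qcm) (at_left c)" and "(q \<longlongrightarrow> qcp) (at_right c)"
    and "(a10, a11) \<noteq> (0, 0)"
    and "Delta12 bm10 bm11 bm20 bm21 > 0" and "Delta34 bp10 bp11 bp20 bp21 > 0"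
    and "Delta0 a20 a21 a20' a21' > 0"
    and "Im lam \<noteq> 0"
  shows
    \<comment> \<open>R(lambda,A) is defined on all of H1\<close>
    "(\<forall>G. in_H1 a c b G \<longrightarrow> (\<exists>F. LA F G)) \<and>
     \<comment> \<open>(lambda - A) is injective (modulo equality in H1), so R(lambda,A) is a well-defined map\<close>
     (\<forall>F F' G G'. LA F G \<and> LA F' G' \<and> H1_eq a c b G G' \<longrightarrow> H1_eq a c b F F') \<and>
     \<comment> \<open>R(lambda,A) is bounded\<close>
     (\<exists>C. \<forall>F G. in_H1 a c b G \<and> LA F G \<longrightarrow> nrm F \<le> C * nrm G) \<and>
     \<comment> \<open>R(lambda,A) is compact: images of bounded sequences have H1-convergent subsequences\<close>
     (\<forall>(Fs::nat \<Rightarrow> H1el) (Gs::nat \<Rightarrow> H1el). (\<forall>n. in_H1 a c b (Gs n) \<and> nrm (Gs n) \<le> 1 \<and> LA (Fs n) (Gs n)) \<longrightarrow>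
        (\<exists>r F. strict_mono r \<and> in_H1 a c b F \<and>
               (\<lambda>n. nrm (H1_diff (Fs (r n)) F)) \<longlonglongrightarrow> 0))"
proof -
  interpret sl_problem a c b q qcm qcp a10 a11 a20 a21 a20' a21' bm10 bm11 bm20 bm21 bp10 bp11 bp20 bp21 lam
    by standard fact+
  show ?thesis
    unfolding LA_def nrm_def
    using LA_surj LA_inj LA_bounded LA_compact by blast
qed

end
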